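(* Let $T$ be any first order theory in a first order language $\mathcal{L}$ (the first order language $\mathcal{L}_{\omega\omega}(S)$ of a single-sorted signature $S$). There exists a Boolean valued model $\mathfrak{M}=(B,|\mathfrak{M}|,[\![-]\!])$ of $T$ such that (i) $\mathfrak{M}$ is a conservative model of $T$: for every sentence $\varphi$ of $\mathcal{L}$, $\mathfrak{M}\models\varphi$ if and only if $T\vdash\varphi$; (ii) every predicate on $\mathfrak{M}$ which is invariant under all automorphisms of $\mathfrak{M}$ is definable.
   Context: A Boolean valued interpretation of $\mathcal{L}$ is a triple $\mathfrak{M}=(B,|\mathfrak{M}|,[\![-]\!])$ where $B$ is a Boolean algebra (not necessarily complete), $|\mathfrak{M}|$ is a set, and $[\![-]\!]$ assigns to each formula $\varphi(x_1,\dots,x_n)$ (free variables among $x_1,\dots,x_n$) a function $|\mathfrak{M}|^n\to B$, $m\mapsto[\![\varphi(m)]\!]$, such that: (i) $[\![(\varphi\wedge\psi)(m)]\!]=[\![\varphi(m)]\!]\wedge[\![\psi(m)]\!]$ and similarly for the other Boolean connectives; (ii) $[\![\exists y\varphi(y,m)]\!]=\bigvee\{[\![\varphi(k,m)]\!]\mid k\in|\mathfrak{M}|\}$ and $[\![\forall y\varphi(y,m)]\!]=\bigwedge\{[\![\varphi(k,m)]\!]\mid k\in|\mathfrak{M}|\}$, where these suprema and infima are required to exist in $B$; (iii) if $\vdash\varphi(x_1,\dots,x_n)$ in classical first order logic then $[\![\varphi(m)]\!]=1_B$ for all $m\in|\mathfrak{M}|^n$. (Constants and function symbols are treated via the formulas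 $c=x$ and $f(x_1,\dots,x_n)=y$.) One writes $\mathfrak{M}\models\varphi$ if $[\![\varphi(m)]\!]=1_B$ for all $m$, and $\mathfrak{M}$ is a model of $T$ if $\mathfrak{M}\models\varphi$ whenever $T\vdash\varphi$. An automorphism $\pi$ of $\mathfrak{M}$ is a pair $(\pi_0,\pi_1)$ with $\pi_0:B\to B$ a Boolean algebra automorphism and $\pi_1:|\mathfrak{M}|\to|\mathfrak{M}|$ a bijection such that $\pi_0[\![\varphi(m_1,\dots,m_n)]\!]=[\![\varphi(\pi_1 m_1,\dots,\pi_1 m_n)]\!]$ for all formulas $\varphi$ and all $m_i$. An $n$-ary predicate on $\mathfrak{M}$ is a map $p:|\mathfrak{M}|^n\to B$ with $p(m)\wedge[\![m=m']\!]\le p(m')$ for all $m,m'\in|\mathfrak{M}|^n$, where $[\![m=m']\!]=\bigwedge_{i=1}^n[\![m_i=m_i']\!]$. It is definable if there is a formula $\varphi(x_1,\dots,x_n)$ with $p(m)=[\![\varphi(m)]\!]$ for all $m$, and invariant under $\pi$ if $\pi_0 p(m)=p(\pi_1 m)$ for all $m$ (with $\pi_1 m=(\pi_1 m_1,\dots,\pi_1 m_n)$). *)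

theory Defs
  imports "HOL-Algebra.Lattice"
begin

section \<open>First-order logic over a single-sorted signature\<close>

text \<open>
  The symbols of a signature are those on which the arity maps are defined, so that a signature
  may have no function symbols or no relation symbols. Constants are function symbols of arity 0.
\<close>

record ('f, 'r) signature =
  fun_arity :: "'f \<Rightarrow> nat option"
  rel_arity :: "'r \<Rightarrow> nat option"

text \<open>Variables are de Bruijn indices; \<open>Uni\<close> and \<open>Exi\<close> bind index 0 of their body.\<close>

datatype 'f tm = Var nat | Fn 'f "'f tm list"

datatype ('f, 'r) fm =
    Fls
  | Eqn "'f tm" "'f tm"
  | Rel 'r "'f tm list"
  | Neg "('f, 'r) fm"
  | Con "('f, 'r) fm" "('f, 'r) fm"
  | Dis "('f, 'r) fm" "('f, 'r) fm"
  | Imp "('f, 'r) fm" "('f, 'r) fm"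
  | Uni "('f, 'r) fm"
  | Exi "('f, 'r) fm"

primrec wf_tm :: "('f, 'r) signature \<Rightarrow> 'f tm \<Rightarrow> bool" where
  "wf_tm S (Var i) \<longleftrightarrow> True"
| "wf_tm S (Fn f ts) \<longleftrightarrow> fun_arity S f = Some (length ts) \<and> list_all (wf_tm S) ts"

primrec wf_fm :: "('f, 'r) signature \<Rightarrow> ('f, 'r) fm \<Rightarrow> bool" where
  "wf_fm S Fls \<longleftrightarrow> True"
| "wf_fm S (Eqn s t) \<longleftrightarrow> wf_tm S s \<and> wf_tm S t"
| "wf_fm S (Rel r ts) \<longleftrightarrow> rel_arity S r = Some (length ts) \<and> list_all (wf_tm S) ts"
| "wf_fm S (Neg \<phi>) \<longleftrightarrow> wf_fm S \<phi>"
| "wf_fm S (Con \<phi> \<psi>) \<longleftrightarrow> wf_fm S \<phi> \<and> wf_fm S \<psi>"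
| "wf_fm S (Dis \<phi> \<psi>) \<longleftrightarrow> wf_fm S \<phi> \<and> wf_fm S \<psi>"
| "wf_fm S (Imp \<phi> \<psi>) \<longleftrightarrow> wf_fm S \<phi> \<and> wf_fm S \<psi>"
| "wf_fm S (Uni \<phi>) \<longleftrightarrow> wf_fm S \<phi>"
| "wf_fm S (Exi \<phi>) \<longleftrightarrow> wf_fm S \<phi>"

primrec fv_tm :: "'f tm \<Rightarrow> nat set" where
  "fv_tm (Var i) = {i}"
| "fv_tm (Fn f ts) = \<Union> (set (map fv_tm ts))"

primrec fv :: "('f, 'r) fm \<Rightarrow> nat set" where
  "fv Fls = {}"
| "fv (Eqn s t) = fv_tm s \<union> fv_tm t"
| "fv (Rel r ts) = \<Union> (set (map fv_tm ts))"
| "fv (Neg \<phi>) = fv \<phi>"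
| "fv (Con \<phi> \<psi>) = fv \<phi> \<union> fv \<psi>"
| "fv (Dis \<phi> \<psi>) = fv \<phi> \<union> fv \<psi>"
| "fv (Imp \<phi> \<psi>) = fv \<phi> \<union> fv \<psi>"
| "fv (Uni \<phi>) = {i. Suc i \<in> fv \<phi>}"
| "fv (Exi \<phi>) = {i. Suc i \<in> fv \<phi>}"

primrec subst_tm :: "(nat \<Rightarrow> 'f tm) \<Rightarrow> 'f tm \<Rightarrow> 'f tm" where
  "subst_tm \<sigma> (Var i) = \<sigma> i"
| "subst_tm \<sigma> (Fn f ts) = Fn f (map (subst_tm \<sigma>) ts)"

text \<open>The substitution to be used under a binder: index 0 is kept, all others are shifted.\<close>

definition up :: "(nat \<Rightarrow> 'f tm) \<Rightarrow> nat \<Rightarrow> 'f tm" where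
  "up \<sigma> = case_nat (Var 0) (\<lambda>i. subst_tm (\<lambda>j. Var (Suc j)) (\<sigma> i))"

primrec subst :: "(nat \<Rightarrow> 'f tm) \<Rightarrow> ('f, 'r) fm \<Rightarrow> ('f, 'r) fm" where
  "subst \<sigma> Fls = Fls"
| "subst \<sigma> (Eqn s t) = Eqn (subst_tm \<sigma> s) (subst_tm \<sigma> t)"
| "subst \<sigma> (Rel r ts) = Rel r (map (subst_tm \<sigma>) ts)"
| "subst \<sigma> (Neg \<phi>) = Neg (subst \<sigma> \<phi>)"
| "subst \<sigma> (Con \<phi> \<psi>) = Con (subst \<sigma> \<phi>) (subst \<sigma> \<psi>)"
| "subst \<sigma> (Dis \<phi> \<psi>) = Dis (subst \<sigma> \<phi>) (subst \<sigma> \<psi>)"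
| "subst \<sigma> (Imp \<phi> \<psi>) = Imp (subst \<sigma> \<phi>) (subst \<sigma> \<psi>)"
| "subst \<sigma> (Uni \<phi>) = Uni (subst (up \<sigma>) \<phi>)"
| "subst \<sigma> (Exi \<phi>) = Exi (subst (up \<sigma>) \<phi>)"

definition lift :: "('f, 'r) fm \<Rightarrow> ('f, 'r) fm" where
  "lift = subst (\<lambda>i. Var (Suc i))"

definition inst :: "'f tm \<Rightarrow> ('f, 'r) fm \<Rightarrow> ('f, 'r) fm" where
  "inst t = subst (case_nat t Var)"

text \<open>
  Classical natural deduction with equality. Contexts are arbitrary, possibly infinite, sets of
  formulas; only formulas of the language of \<open>S\<close> occur as conclusions. Shifting the context in
  \<open>UniI\<close> and \<open>ExiE\<close> is the eigenvariable condition, index 0 being the eigenvariable.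
\<close>

inductive deriv :: "('f, 'r) signature \<Rightarrow> ('f, 'r) fm set \<Rightarrow> ('f, 'r) fm \<Rightarrow> bool"
  for S :: "('f, 'r) signature" where
  Assm: "\<phi> \<in> \<Gamma> \<Longrightarrow> wf_fm S \<phi> \<Longrightarrow> deriv S \<Gamma> \<phi>"
| Raa: "wf_fm S \<phi> \<Longrightarrow> deriv S (insert (Neg \<phi>) \<Gamma>) Fls \<Longrightarrow> deriv S \<Gamma> \<phi>"
| NegI: "wf_fm S \<phi> \<Longrightarrow> deriv S (insert \<phi> \<Gamma>) Fls \<Longrightarrow> deriv S \<Gamma> (Neg \<phi>)"
| NegE: "deriv S \<Gamma> (Neg \<phi>) \<Longrightarrow> deriv S \<Gamma> \<phi> \<Longrightarrow> deriv S \<Gamma> Fls"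
| ConI: "deriv S \<Gamma> \<phi> \<Longrightarrow> deriv S \<Gamma> \<psi> \<Longrightarrow> deriv S \<Gamma> (Con \<phi> \<psi>)"
| ConE1: "deriv S \<Gamma> (Con \<phi> \<psi>) \<Longrightarrow> deriv S \<Gamma> \<phi>"
| ConE2: "deriv S \<Gamma> (Con \<phi> \<psi>) \<Longrightarrow> deriv S \<Gamma> \<psi>"
| DisI1: "wf_fm S \<psi> \<Longrightarrow> deriv S \<Gamma> \<phi> \<Longrightarrow> deriv S \<Gamma> (Dis \<phi> \<psi>)"
| DisI2: "wf_fm S \<phi> \<Longrightarrow> deriv S \<Gamma> \<psi> \<Longrightarrow> deriv S \<Gamma> (Dis \<phi> \<psi>)"
| DisE: "deriv S \<Gamma> (Dis \<phi> \<psi>) \<Longrightarrow> deriv S (insert \<phi> \<Gamma>) \<chi> \<Longrightarrow> deriv S (insert \<psi> \<Gamma>) \<chi>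
    \<Longrightarrow> deriv S \<Gamma> \<chi>"
| ImpI: "wf_fm S \<phi> \<Longrightarrow> deriv S (insert \<phi> \<Gamma>) \<psi> \<Longrightarrow> deriv S \<Gamma> (Imp \<phi> \<psi>)"
| ImpE: "deriv S \<Gamma> (Imp \<phi> \<psi>) \<Longrightarrow> deriv S \<Gamma> \<phi> \<Longrightarrow> deriv S \<Gamma> \<psi>"
| UniI: "deriv S (lift ` \<Gamma>) \<phi> \<Longrightarrow> deriv S \<Gamma> (Uni \<phi>)"
| UniE: "deriv S \<Gamma> (Uni \<phi>) \<Longrightarrow> wf_tm S t \<Longrightarrow> deriv S \<Gamma> (inst t \<phi>)"
| ExiI: "wf_fm S \<phi> \<Longrightarrow> wf_tm S t \<Longrightarrow> deriv S \<Gamma> (inst t \<phi>) \<Longrightarrow> deriv S \<Gamma> (Exi \<phi>)"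
| ExiE: "deriv S \<Gamma> (Exi \<phi>) \<Longrightarrow> deriv S (insert \<phi> (lift ` \<Gamma>)) (lift \<chi>) \<Longrightarrow> deriv S \<Gamma> \<chi>"
| EqnI: "wf_tm S t \<Longrightarrow> deriv S \<Gamma> (Eqn t t)"
| EqnE: "deriv S \<Gamma> (Eqn s t) \<Longrightarrow> deriv S \<Gamma> (inst s \<phi>) \<Longrightarrow> deriv S \<Gamma> (inst t \<phi>)"

definition sentence :: "('f, 'r) signature \<Rightarrow> ('f, 'r) fm \<Rightarrow> bool" where
  "sentence S \<phi> \<longleftrightarrow> wf_fm S \<phi> \<and> fv \<phi> = {}"

definition fo_theory :: "('f, 'r) signature \<Rightarrow> ('f, 'r) fm set \<Rightarrow> bool" where
  "fo_theory S T \<longleftrightarrow> (\<forall>\<phi>\<in>T. sentence S \<phi>)"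


section \<open>Boolean algebras\<close>

text \<open>
  Complemented distributive lattices, not assumed complete. The trivial algebra is allowed: it is
  needed for inconsistent theories.
\<close>

locale boolean_algebra_on = bounded_lattice L for L (structure) +
  assumes meet_join_distrib:
    "\<lbrakk>x \<in> carrier L; y \<in> carrier L; z \<in> carrier L\<rbrakk>
      \<Longrightarrow> x \<sqinter> (y \<squnion> z) = (x \<sqinter> y) \<squnion> (x \<sqinter> z)"
  and compl_exists:
    "x \<in> carrier L \<Longrightarrow> \<exists>y\<in>carrier L. x \<sqinter> y = \<bottom> \<and> x \<squnion> y = \<top>"

definition compl :: "('b, 'c) gorder_scheme \<Rightarrow> 'b \<Rightarrow> 'b" where
  "compl L x = (THE y. y \<in> carrier L \<and> x \<sqinter>\<^bsub>L\<^esub> y = \<bottom>\<^bsub>L\<^esub> \<and> x \<squnion>\<^bsub>L\<^esub> y = \<top>\<^bsub>L\<^esub>)"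

definition ba_automorphism :: "('b, 'c) gorder_scheme \<Rightarrow> ('b \<Rightarrow> 'b) \<Rightarrow> bool" where
  "ba_automorphism L h \<longleftrightarrow>
     bij_betw h (carrier L) (carrier L) \<and>
     (\<forall>x\<in>carrier L. \<forall>y\<in>carrier L.
        h (x \<sqinter>\<^bsub>L\<^esub> y) = h x \<sqinter>\<^bsub>L\<^esub> h y \<and> h (x \<squnion>\<^bsub>L\<^esub> y) = h x \<squnion>\<^bsub>L\<^esub> h y) \<and>
     (\<forall>x\<in>carrier L. h (compl L x) = compl L (h x)) \<and>
     h \<bottom>\<^bsub>L\<^esub> = \<bottom>\<^bsub>L\<^esub> \<and> h \<top>\<^bsub>L\<^esub> = \<top>\<^bsub>L\<^esub>"


section \<open>Boolean valued interpretations\<close>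

definition tuples :: "nat \<Rightarrow> 'm set \<Rightarrow> 'm list set" where
  "tuples n D = {m. set m \<subseteq> D \<and> length m = n}"

text \<open>
  \<open>val M \<phi> m\<close> is the value of \<open>\<phi>\<close> at the tuple \<open>m\<close>, whose \<open>i\<close>-th entry is the value of the free
  variable \<open>i\<close>. It is meaningful if \<open>\<phi>\<close> is a formula of the language with free variables
  among \<open>0, \<dots>, length m - 1\<close>, and unconstrained otherwise.
\<close>

record ('f, 'r, 'b, 'm) bv_structure =
  alg :: "'b gorder"
  univ :: "'m set"
  val :: "('f, 'r) fm \<Rightarrow> 'm list \<Rightarrow> 'b"

definition fm_at :: "('f, 'r) signature \<Rightarrow> nat \<Rightarrow> ('f, 'r) fm \<Rightarrow> bool" where
  "fm_at S n \<phi> \<longleftrightarrow> wf_fm S \<phi> \<and> fv \<phi> \<subseteq> {..<n}"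

text \<open>
  The condition \<open>val_rename\<close> expresses that the value at \<open>m\<close> belongs to the formula with the
  elements of \<open>m\<close> put for its free variables: for instance, the value of \<open>R x x\<close> at \<open>k\<close> is that of
  \<open>R x y\<close> at \<open>(k, k)\<close>, and variables that do not occur may be added to the list of variables.
  The conditions \<open>val_exi\<close> and \<open>val_uni\<close> include the existence of the supremum and the infimum.
\<close>

locale bv_interpretation =
  fixes S :: "('f, 'r) signature" and M :: "('f, 'r, 'b, 'm) bv_structure"
  assumes alg_boolean: "boolean_algebra_on (alg M)"
  and val_closed:
    "\<lbrakk>m \<in> tuples n (univ M); fm_at S n \<phi>\<rbrakk> \<Longrightarrow> val M \<phi> m \<in> carrier (alg M)"
  and val_rename:
    "\<lbrakk>m \<in> tuples k (univ M); fm_at S n \<phi>; \<forall>i<n. \<rho> i < k\<rbrakk>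
      \<Longrightarrow> val M (subst (\<lambda>i. Var (\<rho> i)) \<phi>) m = val M \<phi> (map (\<lambda>i. m ! \<rho> i) [0..<n])"
  and val_fls:
    "m \<in> tuples n (univ M) \<Longrightarrow> val M Fls m = \<bottom>\<^bsub>alg M\<^esub>"
  and val_neg:
    "\<lbrakk>m \<in> tuples n (univ M); fm_at S n \<phi>\<rbrakk> \<Longrightarrow> val M (Neg \<phi>) m = compl (alg M) (val M \<phi> m)"
  and val_con:
    "\<lbrakk>m \<in> tuples n (univ M); fm_at S n \<phi>; fm_at S n \<psi>\<rbrakk>
      \<Longrightarrow> val M (Con \<phi> \<psi>) m = val M \<phi> m \<sqinter>\<^bsub>alg M\<^esub> val M \<psi> m"
  and val_dis:
    "\<lbrakk>m \<in> tuples n (univ M); fm_at S n \<phi>; fm_at S n \<psi>\<rbrakk>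
      \<Longrightarrow> val M (Dis \<phi> \<psi>) m = val M \<phi> m \<squnion>\<^bsub>alg M\<^esub> val M \<psi> m"
  and val_imp:
    "\<lbrakk>m \<in> tuples n (univ M); fm_at S n \<phi>; fm_at S n \<psi>\<rbrakk>
      \<Longrightarrow> val M (Imp \<phi> \<psi>) m = compl (alg M) (val M \<phi> m) \<squnion>\<^bsub>alg M\<^esub> val M \<psi> m"
  and val_exi:
    "\<lbrakk>m \<in> tuples n (univ M); fm_at S (Suc n) \<phi>\<rbrakk>
      \<Longrightarrow> least (alg M) (val M (Exi \<phi>) m)
            (Upper (alg M) {val M \<phi> (k # m) | k. k \<in> univ M})"
  and val_uni:
    "\<lbrakk>m \<in> tuples n (univ M); fm_at S (Suc n) \<phi>\<rbrakk>
      \<Longrightarrow> greatest (alg M) (val M (Uni \<phi>) m)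
            (Lower (alg M) {val M \<phi> (k # m) | k. k \<in> univ M})"
  and val_logic:
    "\<lbrakk>m \<in> tuples n (univ M); fm_at S n \<phi>; deriv S {} \<phi>\<rbrakk> \<Longrightarrow> val M \<phi> m = \<top>\<^bsub>alg M\<^esub>"

definition bv_sat :: "('f, 'r, 'b, 'm) bv_structure \<Rightarrow> ('f, 'r) fm \<Rightarrow> bool" where
  "bv_sat M \<phi> \<longleftrightarrow>
     (\<forall>n. fv \<phi> \<subseteq> {..<n} \<longrightarrow> (\<forall>m\<in>tuples n (univ M). val M \<phi> m = \<top>\<^bsub>alg M\<^esub>))"

definition bv_model ::
  "('f, 'r) signature \<Rightarrow> ('f, 'r) fm set \<Rightarrow> ('f, 'r, 'b, 'm) bv_structure \<Rightarrow> bool" where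
  "bv_model S T M \<longleftrightarrow> bv_interpretation S M \<and> (\<forall>\<phi>. deriv S T \<phi> \<longrightarrow> bv_sat M \<phi>)"

definition bv_conservative ::
  "('f, 'r) signature \<Rightarrow> ('f, 'r) fm set \<Rightarrow> ('f, 'r, 'b, 'm) bv_structure \<Rightarrow> bool" where
  "bv_conservative S T M \<longleftrightarrow> (\<forall>\<phi>. sentence S \<phi> \<longrightarrow> (bv_sat M \<phi> \<longleftrightarrow> deriv S T \<phi>))"

definition bv_automorphism ::
  "('f, 'r) signature \<Rightarrow> ('f, 'r, 'b, 'm) bv_structure \<Rightarrow> ('b \<Rightarrow> 'b) \<times> ('m \<Rightarrow> 'm) \<Rightarrow> bool" where
  "bv_automorphism S M = (\<lambda>(\<pi>\<^sub>0, \<pi>\<^sub>1).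
     ba_automorphism (alg M) \<pi>\<^sub>0 \<and> bij_betw \<pi>\<^sub>1 (univ M) (univ M) \<and>
     (\<forall>n \<phi>. fm_at S n \<phi> \<longrightarrow>
        (\<forall>m\<in>tuples n (univ M). \<pi>\<^sub>0 (val M \<phi> m) = val M \<phi> (map \<pi>\<^sub>1 m))))"

definition eq_val :: "('f, 'r, 'b, 'm) bv_structure \<Rightarrow> 'm list \<Rightarrow> 'm list \<Rightarrow> 'b" where
  "eq_val M m m' =
     \<Sqinter>\<^bsub>alg M\<^esub> {val M (Eqn (Var 0) (Var 1)) [m ! i, m' ! i] | i. i < length m}"

definition bv_predicate ::
  "('f, 'r, 'b, 'm) bv_structure \<Rightarrow> nat \<Rightarrow> ('m list \<Rightarrow> 'b) \<Rightarrow> bool" where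
  "bv_predicate M n p \<longleftrightarrow>
     (\<forall>m\<in>tuples n (univ M). p m \<in> carrier (alg M)) \<and>
     (\<forall>m\<in>tuples n (univ M). \<forall>m'\<in>tuples n (univ M).
        p m \<sqinter>\<^bsub>alg M\<^esub> eq_val M m m' \<sqsubseteq>\<^bsub>alg M\<^esub> p m')"

definition definable ::
  "('f, 'r) signature \<Rightarrow> ('f, 'r, 'b, 'm) bv_structure \<Rightarrow> nat \<Rightarrow> ('m list \<Rightarrow> 'b) \<Rightarrow> bool" where
  "definable S M n p \<longleftrightarrow> (\<exists>\<phi>. fm_at S n \<phi> \<and> (\<forall>m\<in>tuples n (univ M). p m = val M \<phi> m))"

definition invariant_under ::
  "('f, 'r, 'b, 'm) bv_structure \<Rightarrow> nat \<Rightarrow> ('m list \<Rightarrow> 'b) \<Rightarrow> ('b \<Rightarrow> 'b) \<times> ('m \<Rightarrow> 'm) \<Rightarrow> bool" where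
  "invariant_under M n p = (\<lambda>(\<pi>\<^sub>0, \<pi>\<^sub>1).
     \<forall>m\<in>tuples n (univ M). \<pi>\<^sub>0 (p m) = p (map \<pi>\<^sub>1 m))"

end

theory Submission
  imports Defs
begin

text \<open>
  The model is the generic one: its elements are the variables and its algebra is the Lindenbaum
  algebra of formulas with free variables modulo \<open>T\<close>. A formula has finitely many free
  variables, so quantifiers are suprema and infima over all variables, and values are \<open>\<top>\<close> exactly
  for the theorems of \<open>T\<close>.

  Permutations of the variables are automorphisms. If \<open>p\<close> is an invariant predicate and
  \<open>\<theta>(x, y)\<close> represents its value at distinct variables \<open>x\<close>, then \<open>\<theta>(x, y)\<close> is equivalent to
  \<open>\<theta>(x, y')\<close> for fresh \<open>y'\<close>, hence to \<open>\<phi>(x) = \<forall>y. \<theta>(x, y)\<close>. By invariance \<open>\<phi>\<close> computes \<open>p\<close> at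
  every tuple of distinct variables. For an arbitrary tuple \<open>m\<close> choose distinct variables \<open>z\<close> that
  are fresh for \<open>m\<close> and \<open>p(m)\<close>: then \<open>p(m)\<close> and \<open>\<phi>(z)\<close> are equivalent under \<open>m = z\<close>, and
  substituting \<open>m\<close> for \<open>z\<close> shows that \<open>p(m)\<close> is \<open>\<phi>(m)\<close>.
\<close>

section \<open>Substitution\<close>

lemma subst_tm_cong: "(\<And>i. i \<in> fv_tm t \<Longrightarrow> \<sigma> i = \<tau> i) \<Longrightarrow> subst_tm \<sigma> t = subst_tm \<tau> t"
  by (induction t) auto

lemma subst_cong: "(\<And>i. i \<in> fv \<phi> \<Longrightarrow> \<sigma> i = \<tau> i) \<Longrightarrow> subst \<sigma> \<phi> = subst \<tau> \<phi>"
proof (induction \<phi> arbitrary: \<sigma> \<tau>)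
  case (Eqn s t)
  then show ?case by (auto intro!: subst_tm_cong)
next
  case (Rel r ts)
  then show ?case by (auto intro!: subst_tm_cong)
next
  case (Uni \<phi>)
  then have "subst (up \<sigma>) \<phi> = subst (up \<tau>) \<phi>"
    by (intro Uni.IH) (auto simp: up_def split: nat.split)
  then show ?case by simp
next
  case (Exi \<phi>)
  then have "subst (up \<sigma>) \<phi> = subst (up \<tau>) \<phi>"
    by (intro Exi.IH) (auto simp: up_def split: nat.split)
  then show ?case by simp
next
  case (Con \<phi> \<psi>)
  then show ?case by (metis UnCI fv.simps(5) subst.simps(5))
next
  case (Dis \<phi> \<psi>)
  then show ?case by (metis UnCI fv.simps(6) subst.simps(6))
next
  case (Imp \<phi> \<psi>)
  then show ?case by (metis UnCI fv.simps(7) subst.simps(7))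
next
  case (Neg \<phi>)
  then show ?case by (metis fv.simps(4) subst.simps(4))
qed simp

lemma subst_tm_Var [simp]: "subst_tm Var t = t"
  by (induction t) (auto intro: map_idI)

lemma up_Var [simp]: "up Var = Var"
  by (auto simp: up_def split: nat.split)

lemma subst_Var [simp]: "subst Var \<phi> = \<phi>"
  by (induction \<phi>) (auto intro: map_idI)

lemma subst_tm_comp: "subst_tm \<sigma> (subst_tm \<tau> t) = subst_tm (\<lambda>i. subst_tm \<sigma> (\<tau> i)) t"
  by (induction t) auto

lemma up_comp: "(\<lambda>i. subst_tm (up \<sigma>) (up \<tau> i)) = up (\<lambda>i. subst_tm \<sigma> (\<tau> i))"
  by (auto simp: up_def subst_tm_comp split: nat.split)

lemma subst_comp: "subst \<sigma> (subst \<tau> \<phi>) = subst (\<lambda>i. subst_tm \<sigma> (\<tau> i)) \<phi>"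
  by (induction \<phi> arbitrary: \<sigma> \<tau>) (auto simp: subst_tm_comp up_comp)

lemma subst_ident: "(\<And>i. i \<in> fv \<phi> \<Longrightarrow> \<sigma> i = Var i) \<Longrightarrow> subst \<sigma> \<phi> = \<phi>"
  using subst_cong[of \<phi> \<sigma> Var] by simp

lemma subst_up_lift: "subst (up \<sigma>) (lift \<phi>) = lift (subst \<sigma> \<phi>)"
  by (simp add: lift_def subst_comp up_def)

lemma subst_inst: "subst \<sigma> (inst t \<phi>) = inst (subst_tm \<sigma> t) (subst (up \<sigma>) \<phi>)"
  unfolding inst_def subst_comp
  by (rule subst_cong) (auto simp: up_def subst_tm_comp split: nat.split)

text \<open>Identifies the body of a quantifier evaluated at the extended environment with an
  instance of the substituted body; \<open>instances_eq\<close> depends on this.\<close>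

lemma inst_subst_up: "inst t (subst (up \<sigma>) \<phi>) = subst (case_nat t \<sigma>) \<phi>"
  unfolding inst_def subst_comp
  by (rule subst_cong) (auto simp: up_def subst_tm_comp split: nat.split)

text \<open>A renaming remains a renaming under a binder, so inductions over formulas can stay
  within renamings.\<close>

lemma up_rename: "up (\<lambda>i. Var (\<rho> i)) = (\<lambda>i. Var (case_nat 0 (\<lambda>i. Suc (\<rho> i)) i))"
  by (auto simp: up_def split: nat.split)

lemma fv_tm_rename: "fv_tm (subst_tm (\<lambda>i. Var (\<rho> i)) t) = \<rho> ` fv_tm t"
  by (induction t) auto

lemma fv_rename: "fv (subst (\<lambda>i. Var (\<rho> i)) \<phi>) \<subseteq> \<rho> ` fv \<phi>"
proof (induction \<phi> arbitrary: \<rho>)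
  case (Uni \<phi>)
  show ?case using Uni.IH[of "case_nat 0 (\<lambda>i. Suc (\<rho> i))"]
    by (fastforce simp: up_rename split: nat.splits)
next
  case (Exi \<phi>)
  show ?case using Exi.IH[of "case_nat 0 (\<lambda>i. Suc (\<rho> i))"]
    by (fastforce simp: up_rename split: nat.splits)
next
  case (Con \<phi> \<psi>)
  show ?case using Con.IH[of \<rho>] by auto
next
  case (Dis \<phi> \<psi>)
  show ?case using Dis.IH[of \<rho>] by auto
next
  case (Imp \<phi> \<psi>)
  show ?case using Imp.IH[of \<rho>] by auto
qed (auto simp: fv_tm_rename)

lemma finite_fv_tm: "finite (fv_tm t)"
  by (induction t) auto

lemma finite_fv: "finite (fv \<phi>)"
proof (induction \<phi>)
  case (Uni \<phi>)
  then show ?case using finite_vimageI[of "fv \<phi>" Suc] by (simp add: vimage_def)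
next
  case (Exi \<phi>)
  then show ?case using finite_vimageI[of "fv \<phi>" Suc] by (simp add: vimage_def)
qed (auto simp: finite_fv_tm)

lemma fv_bound: "\<exists>n. fv \<phi> \<subseteq> {..<n}"
  using finite_fv[of \<phi>] unfolding finite_nat_set_iff_bounded by blast

lemma wf_subst_tm: "wf_tm S t \<Longrightarrow> (\<And>i. wf_tm S (\<sigma> i)) \<Longrightarrow> wf_tm S (subst_tm \<sigma> t)"
  by (induction t) (auto simp: list_all_iff)

lemma wf_up: "(\<And>i. wf_tm S (\<sigma> i)) \<Longrightarrow> wf_tm S (up \<sigma> i)"
  by (auto simp: up_def wf_subst_tm split: nat.split)

lemma wf_subst: "wf_fm S \<phi> \<Longrightarrow> (\<And>i. wf_tm S (\<sigma> i)) \<Longrightarrow> wf_fm S (subst \<sigma> \<phi>)"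
  by (induction \<phi> arbitrary: \<sigma>) (auto simp: list_all_iff wf_subst_tm wf_up)

lemma wf_tm_of_subst: "wf_tm S (subst_tm \<sigma> t) \<Longrightarrow> wf_tm S t"
  by (induction t) (auto simp: list_all_iff)

text \<open>Substitution leaves all symbols and argument counts in place. This serves
  \<open>deriv_wf\<close>, where \<open>EqnE\<close> and \<open>ExiE\<close> present a formula only
  through an instance or a shift of it.\<close>

lemma wf_of_subst: "wf_fm S (subst \<sigma> \<phi>) \<Longrightarrow> wf_fm S \<phi>"
  by (induction \<phi> arbitrary: \<sigma>) (auto simp: list_all_iff intro: wf_tm_of_subst)

lemma wf_inst: "wf_fm S \<phi> \<Longrightarrow> wf_tm S t \<Longrightarrow> wf_fm S (inst t \<phi>)"
  unfolding inst_def by (rule wf_subst) (auto split: nat.split)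

section \<open>Derivations\<close>

lemma deriv_wf: "deriv S \<Gamma> \<phi> \<Longrightarrow> wf_fm S \<phi>"
proof (induction rule: deriv.induct)
  case (EqnE \<Gamma> s t \<phi>)
  then show ?case by (metis inst_def wf_fm.simps(2) wf_inst wf_of_subst)
next
  case (ExiE \<Gamma> \<phi> \<chi>)
  then show ?case by (metis lift_def wf_of_subst)
qed (auto intro: wf_inst)

lemma deriv_mono: "deriv S \<Gamma> \<phi> \<Longrightarrow> \<Gamma> \<subseteq> \<Delta> \<Longrightarrow> deriv S \<Delta> \<phi>"
proof (induction arbitrary: \<Delta> rule: deriv.induct)
  case (Raa \<phi> \<Gamma>)
  then show ?case by (meson deriv.Raa insert_mono)
next
  case (NegI \<phi> \<Gamma>)
  then show ?case by (meson deriv.NegI insert_mono)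
next
  case (DisE \<Gamma> \<phi> \<psi> \<chi>)
  then show ?case by (meson deriv.DisE insert_mono)
next
  case (ImpI \<phi> \<Gamma> \<psi>)
  then show ?case by (meson deriv.ImpI insert_mono)
next
  case (UniI \<Gamma> \<phi>)
  then show ?case by (meson deriv.UniI image_mono)
next
  case (ExiE \<Gamma> \<phi> \<chi>)
  then show ?case by (meson deriv.ExiE insert_mono image_mono)
next
  case (NegE \<Gamma> \<phi>)
  then show ?case by (meson deriv.NegE)
next
  case (EqnE \<Gamma> s t \<phi>)
  then show ?case by (meson deriv.EqnE)
qed (auto intro: deriv.intros)

text \<open>Derivations are closed under simultaneous substitution. The induction generalizes over
  \<sigma>, because the eigenvariable rules call for \<open>up \<sigma>\<close>;
  \<open>subst_up_lift\<close> and \<open>subst_inst\<close> then restore the shape of each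
  rule.\<close>

lemma deriv_subst:
  "deriv S \<Gamma> \<phi> \<Longrightarrow> (\<And>i. wf_tm S (\<sigma> i)) \<Longrightarrow> deriv S (subst \<sigma> ` \<Gamma>) (subst \<sigma> \<phi>)"
proof (induction arbitrary: \<sigma> rule: deriv.induct)
  case (Assm \<phi> \<Gamma>)
  then show ?case by (simp add: deriv.Assm wf_subst)
next
  case (Raa \<phi> \<Gamma>)
  then show ?case using Raa.IH[of \<sigma>] by (auto intro: deriv.Raa wf_subst)
next
  case (NegI \<phi> \<Gamma>)
  then show ?case using NegI.IH[of \<sigma>] by (auto intro: deriv.NegI wf_subst)
next
  case (NegE \<Gamma> \<phi>)
  then show ?case using NegE.IH[of \<sigma>] by (auto intro: deriv.NegE)
next
  case (ConI \<Gamma> \<phi> \<psi>)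
  then show ?case by (auto intro: deriv.ConI)
next
  case (ConE1 \<Gamma> \<phi> \<psi>)
  then show ?case using ConE1.IH[of \<sigma>] by (auto intro: deriv.ConE1)
next
  case (ConE2 \<Gamma> \<phi> \<psi>)
  then show ?case using ConE2.IH[of \<sigma>] by (auto intro: deriv.ConE2)
next
  case (DisI1 \<psi> \<Gamma> \<phi>)
  then show ?case by (auto intro: deriv.DisI1 wf_subst)
next
  case (DisI2 \<phi> \<Gamma> \<psi>)
  then show ?case by (auto intro: deriv.DisI2 wf_subst)
next
  case (DisE \<Gamma> \<phi> \<psi> \<chi>)
  then show ?case using DisE.IH[of \<sigma>] by (auto intro: deriv.DisE)
next
  case (ImpI \<phi> \<Gamma> \<psi>)
  then show ?case using ImpI.IH[of \<sigma>] by (auto intro: deriv.ImpI wf_subst)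
next
  case (ImpE \<Gamma> \<phi> \<psi>)
  then show ?case using ImpE.IH[of \<sigma>] by (auto intro: deriv.ImpE)
next
  case (UniI \<Gamma> \<phi>)
  then have "deriv S (subst (up \<sigma>) ` lift ` \<Gamma>) (subst (up \<sigma>) \<phi>)" by (simp add: wf_up)
  then show ?case by (auto simp: image_image subst_up_lift intro: deriv.UniI)
next
  case (UniE \<Gamma> \<phi> t)
  then show ?case using UniE.IH[of \<sigma>] by (auto simp: subst_inst wf_subst_tm intro: deriv.UniE)
next
  case (ExiI \<phi> t \<Gamma>)
  then show ?case using ExiI.IH[of \<sigma>] deriv.ExiI[of S "subst (up \<sigma>) \<phi>" "subst_tm \<sigma> t"]
    by (simp add: subst_inst wf_subst_tm wf_subst wf_up)
next
  case (ExiE \<Gamma> \<phi> \<chi>)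
  then have "deriv S (subst (up \<sigma>) ` insert \<phi> (lift ` \<Gamma>)) (subst (up \<sigma>) (lift \<chi>))"
    by (simp add: wf_up)
  then show ?case using ExiE.IH(1)[of \<sigma>] ExiE.prems
    by (auto simp: image_image subst_up_lift intro: deriv.ExiE)
next
  case (EqnI t \<Gamma>)
  then show ?case by (auto simp: wf_subst_tm intro: deriv.EqnI)
next
  case (EqnE \<Gamma> s t \<phi>)
  then show ?case using EqnE.IH[of \<sigma>] by (auto simp: subst_inst intro: deriv.EqnE)
qed

lemma deriv_cut: "deriv S \<Gamma> \<phi> \<Longrightarrow> deriv S (insert \<phi> \<Gamma>) \<psi> \<Longrightarrow> deriv S \<Gamma> \<psi>"
  by (meson ImpE ImpI deriv_wf)

lemma deriv_FlsE: "deriv S \<Gamma> Fls \<Longrightarrow> wf_fm S \<phi> \<Longrightarrow> deriv S \<Gamma> \<phi>"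
  by (meson Raa deriv_mono subset_insertI)

section \<open>The Lindenbaum algebra\<close>

locale closed_theory =
  fixes S :: "('f, 'r) signature" and T :: "('f, 'r) fm set"
  assumes fo_theory: "fo_theory S T"
begin

text \<open>The order of the Lindenbaum algebra. Free variables of the premise act as parameters:
  since the rules shift the whole context, they cannot be generalized.\<close>

definition entails :: "('f, 'r) fm \<Rightarrow> ('f, 'r) fm \<Rightarrow> bool" where
  "entails \<phi> \<psi> \<longleftrightarrow> deriv S (insert \<phi> T) \<psi>"

text \<open>Axioms are sentences, so no substitution changes them. Hence entailment is stable under
  substitution, and the shift in the eigenvariable rules leaves \<open>T\<close> alone.\<close>

lemma subst_theory: "subst \<sigma> ` T = T"
proof -
  have "subst \<sigma> \<phi> = \<phi>" if "\<phi> \<in> T" for \<phi>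
    using that fo_theory by (intro subst_ident) (auto simp: fo_theory_def sentence_def)
  then show ?thesis by simp
qed

lemma lift_theory: "lift ` T = T"
  by (simp add: lift_def subst_theory)

section \<open>Propositional laws of entailment over \<open>T\<close>\<close>

lemma entails_refl: "wf_fm S \<phi> \<Longrightarrow> entails \<phi> \<phi>"
  by (simp add: entails_def Assm)

lemma entails_trans: "entails \<phi> \<psi> \<Longrightarrow> entails \<psi> \<chi> \<Longrightarrow> entails \<phi> \<chi>"
  unfolding entails_def by (erule deriv_cut) (erule deriv_mono, auto)

lemma entails_subst:
  "entails \<phi> \<psi> \<Longrightarrow> (\<And>i. wf_tm S (\<sigma> i)) \<Longrightarrow> entails (subst \<sigma> \<phi>) (subst \<sigma> \<psi>)"
  unfolding entails_def using deriv_subst[of S "insert \<phi> T" \<psi> \<sigma>] by (simp add: subst_theory)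

lemma deriv_entails: "deriv S T \<phi> \<Longrightarrow> entails \<chi> \<phi>"
  unfolding entails_def by (erule deriv_mono) auto

text \<open>\<open>Neg Fls\<close> plays the part of truth, for which the syntax has no
  constructor.\<close>

lemma entails_Neg_Fls: "entails (Neg Fls) \<phi> \<Longrightarrow> deriv S T \<phi>"
  unfolding entails_def by (rule deriv_cut[where \<phi>="Neg Fls"]) (rule NegI; auto intro: Assm)

lemma entails_Con_iff: "entails \<chi> (Con \<phi> \<psi>) \<longleftrightarrow> entails \<chi> \<phi> \<and> entails \<chi> \<psi>"
  unfolding entails_def by (meson ConI ConE1 ConE2)

lemma entails_Con1: "wf_fm S \<phi> \<Longrightarrow> wf_fm S \<psi> \<Longrightarrow> entails (Con \<phi> \<psi>) \<phi>"
  and entails_Con2: "wf_fm S \<phi> \<Longrightarrow> wf_fm S \<psi> \<Longrightarrow> entails (Con \<phi> \<psi>) \<psi>"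
  using entails_Con_iff entails_refl[of "Con \<phi> \<psi>"] by simp_all

text \<open>The adjunction between conjunction and implication, from which distributivity will
  follow.\<close>

lemma entails_Imp_iff:
  assumes "wf_fm S \<phi>" "wf_fm S \<chi>"
  shows "entails \<chi> (Imp \<phi> \<psi>) \<longleftrightarrow> entails (Con \<chi> \<phi>) \<psi>"
proof
  assume "entails \<chi> (Imp \<phi> \<psi>)"
  then have "entails (Con \<chi> \<phi>) (Imp \<phi> \<psi>)" using assms entails_trans entails_Con1 by blast
  then show "entails (Con \<chi> \<phi>) \<psi>"
    using assms entails_Con2[of \<chi> \<phi>] unfolding entails_def by (metis ImpE)
next
  assume "entails (Con \<chi> \<phi>) \<psi>"
  then have "deriv S (insert (Con \<chi> \<phi>) (insert \<phi> (insert \<chi> T))) \<psi>"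
    unfolding entails_def by (rule deriv_mono) auto
  moreover have "deriv S (insert \<phi> (insert \<chi> T)) (Con \<chi> \<phi>)"
    using assms by (intro ConI Assm) auto
  ultimately show "entails \<chi> (Imp \<phi> \<psi>)"
    unfolding entails_def using assms deriv_cut ImpI by blast
qed

lemma entails_Dis1: "wf_fm S \<phi> \<Longrightarrow> wf_fm S \<psi> \<Longrightarrow> entails \<phi> (Dis \<phi> \<psi>)"
  and entails_Dis2: "wf_fm S \<phi> \<Longrightarrow> wf_fm S \<psi> \<Longrightarrow> entails \<psi> (Dis \<phi> \<psi>)"
  unfolding entails_def by (auto intro: DisI1 DisI2 Assm)

lemma entails_Dis_iff:
  assumes "wf_fm S \<phi>" "wf_fm S \<psi>"
  shows "entails (Dis \<phi> \<psi>) \<chi> \<longleftrightarrow> entails \<phi> \<chi> \<and> entails \<psi> \<chi>"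
proof
  assume "entails (Dis \<phi> \<psi>) \<chi>"
  then show "entails \<phi> \<chi> \<and> entails \<psi> \<chi>"
    using assms entails_Dis1 entails_Dis2 entails_trans by blast
next
  assume *: "entails \<phi> \<chi> \<and> entails \<psi> \<chi>"
  have "deriv S (insert (Dis \<phi> \<psi>) T) (Dis \<phi> \<psi>)"
    using assms by (intro Assm) auto
  moreover have "deriv S (insert \<phi> (insert (Dis \<phi> \<psi>) T)) \<chi>"
    using * unfolding entails_def by (auto elim: deriv_mono)
  moreover have "deriv S (insert \<psi> (insert (Dis \<phi> \<psi>) T)) \<chi>"
    using * unfolding entails_def by (auto elim: deriv_mono)
  ultimately show "entails (Dis \<phi> \<psi>) \<chi>" unfolding entails_def by (rule DisE)
qed

lemma entails_Fls: "wf_fm S \<phi> \<Longrightarrow> entails Fls \<phi>"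
  unfolding entails_def by (rule deriv_FlsE[OF Assm]) auto

lemma entails_true: "entails \<phi> (Neg Fls)"
  unfolding entails_def by (rule NegI) (auto intro: Assm)

lemma entails_Con_Neg: "wf_fm S \<phi> \<Longrightarrow> entails (Con \<phi> (Neg \<phi>)) Fls"
  using entails_Con1[of \<phi> "Neg \<phi>"] entails_Con2[of \<phi> "Neg \<phi>"]
  unfolding entails_def by simp (rule NegE)

lemma entails_excluded_middle:
  assumes "wf_fm S \<phi>"
  shows "entails \<chi> (Dis \<phi> (Neg \<phi>))"
proof -
  let ?D = "Dis \<phi> (Neg \<phi>)"
  \<comment> \<open>Under \<open>Neg ?D\<close>, assuming \<phi> yields \<open>?D\<close> and a
    contradiction. So \<open>Neg \<phi>\<close> holds there, which yields \<open>?D\<close> once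
    more, and \<open>Raa\<close> discharges \<open>Neg ?D\<close>.\<close>
  have "deriv S (insert \<phi> (insert (Neg ?D) T)) ?D" "deriv S (insert \<phi> (insert (Neg ?D) T)) (Neg ?D)"
    using assms by (auto intro: DisI1 Assm)
  then have "deriv S (insert (Neg ?D) T) (Neg \<phi>)" using assms NegE NegI by blast
  then have "deriv S (insert (Neg ?D) T) ?D" using assms by (intro DisI2) auto
  moreover have "deriv S (insert (Neg ?D) T) (Neg ?D)" using assms by (intro Assm) auto
  ultimately have "deriv S (insert (Neg ?D) T) Fls" by (rule NegE[rotated])
  then have "deriv S T ?D" using assms by (simp add: Raa)
  then show ?thesis by (rule deriv_entails)
qed

lemma entails_Con_commute:
  "wf_fm S \<phi> \<Longrightarrow> wf_fm S \<psi> \<Longrightarrow> entails (Con \<phi> \<psi>) \<chi> \<Longrightarrow> entails (Con \<psi> \<phi>) \<chi>"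
  by (meson entails_Con1 entails_Con2 entails_Con_iff entails_trans)

text \<open>Distributivity as a mapping property: conjunction with \<phi> is a left adjoint by
  \<open>entails_Imp_iff\<close>, so it preserves disjunctions.\<close>

lemma entails_Con_Dis:
  assumes "wf_fm S \<phi>" "wf_fm S \<psi>" "wf_fm S \<chi>"
  shows "entails (Con \<phi> (Dis \<psi> \<chi>)) \<xi> \<longleftrightarrow> entails (Con \<phi> \<psi>) \<xi> \<and> entails (Con \<phi> \<chi>) \<xi>"
proof -
  have "entails (Con \<phi> (Dis \<psi> \<chi>)) \<xi> \<longleftrightarrow> entails (Dis \<psi> \<chi>) (Imp \<phi> \<xi>)"
    using assms by (simp add: entails_Imp_iff) (meson entails_Con_commute wf_fm.simps(6))
  also have "\<dots> \<longleftrightarrow> entails (Con \<psi> \<phi>) \<xi> \<and> entails (Con \<chi> \<phi>) \<xi>"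
    using assms by (simp add: entails_Dis_iff flip: entails_Imp_iff)
  also have "\<dots> \<longleftrightarrow> entails (Con \<phi> \<psi>) \<xi> \<and> entails (Con \<phi> \<chi>) \<xi>"
    using assms by (meson entails_Con_commute)
  finally show ?thesis .
qed

text \<open>Complements in a distributive lattice are unique: split \<psi> along \<phi> or
  \<open>Neg \<phi>\<close>, and split \<open>Neg \<phi>\<close> along \<phi> or \<psi>. The
  definite description in \<open>compl\<close> requires this.\<close>

lemma entails_Neg_unique:
  assumes wf: "wf_fm S \<phi>" "wf_fm S \<psi>"
    and Con: "entails (Con \<phi> \<psi>) Fls" and Dis: "entails (Neg Fls) (Dis \<phi> \<psi>)"
  shows "entails \<psi> (Neg \<phi>)" "entails (Neg \<phi>) \<psi>"
proof -
  have "entails (Con \<psi> \<phi>) (Neg \<phi>)"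
    using wf Con by (meson entails_Con_commute entails_Fls entails_trans wf_fm.simps(4))
  moreover have "entails (Con \<psi> (Neg \<phi>)) (Neg \<phi>)" using wf by (simp add: entails_Con2)
  ultimately have "entails (Con \<psi> (Dis \<phi> (Neg \<phi>))) (Neg \<phi>)" using wf by (simp add: entails_Con_Dis)
  then show "entails \<psi> (Neg \<phi>)"
    by (meson entails_Con_iff entails_excluded_middle entails_refl entails_trans wf)
  have "entails (Con (Neg \<phi>) \<phi>) \<psi>"
    using wf by (meson entails_Con_Neg entails_Con_commute entails_Fls entails_trans wf_fm.simps(4))
  moreover have "entails (Con (Neg \<phi>) \<psi>) \<psi>" using wf by (simp add: entails_Con2)
  ultimately have "entails (Con (Neg \<phi>) (Dis \<phi> \<psi>)) \<psi>" using wf by (simp add: entails_Con_Dis)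
  moreover have "entails (Neg \<phi>) (Con (Neg \<phi>) (Dis \<phi> \<psi>))"
    using wf Dis by (meson entails_Con_iff entails_refl entails_trans entails_true wf_fm.simps(4))
  ultimately show "entails (Neg \<phi>) \<psi>" by (rule entails_trans[rotated])
qed

text \<open>Implication is a primitive connective, while an interpretation must value it as a join
  with a complement; classical logic makes the two agree.\<close>

lemma entails_Imp_Dis:
  assumes "wf_fm S \<phi>" "wf_fm S \<psi>"
  shows "entails (Imp \<phi> \<psi>) (Dis (Neg \<phi>) \<psi>)" "entails (Dis (Neg \<phi>) \<psi>) (Imp \<phi> \<psi>)"
proof -
  have "entails (Con (Imp \<phi> \<psi>) \<phi>) \<psi>"
    using assms by (simp flip: entails_Imp_iff add: entails_refl)
  then have "entails (Con (Imp \<phi> \<psi>) \<phi>) (Dis (Neg \<phi>) \<psi>)"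
    using assms by (meson entails_Dis2 entails_trans wf_fm.simps(4))
  moreover have "entails (Con (Imp \<phi> \<psi>) (Neg \<phi>)) (Dis (Neg \<phi>) \<psi>)"
    using assms by (meson entails_Con2 entails_Dis1 entails_trans wf_fm.simps(4,7))
  ultimately have "entails (Con (Imp \<phi> \<psi>) (Dis \<phi> (Neg \<phi>))) (Dis (Neg \<phi>) \<psi>)"
    using assms by (simp add: entails_Con_Dis)
  moreover have "entails (Imp \<phi> \<psi>) (Con (Imp \<phi> \<psi>) (Dis \<phi> (Neg \<phi>)))"
    using assms by (simp add: entails_Con_iff entails_refl entails_excluded_middle)
  ultimately show "entails (Imp \<phi> \<psi>) (Dis (Neg \<phi>) \<psi>)" using entails_trans by blast
  have "entails (Con (Neg \<phi>) \<phi>) \<psi>"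
    using assms by (meson entails_Con_Neg entails_Con_commute entails_Fls entails_trans wf_fm.simps(4))
  then show "entails (Dis (Neg \<phi>) \<psi>) (Imp \<phi> \<psi>)"
    using assms by (simp add: entails_Dis_iff)
      (simp add: entails_Imp_iff entails_Con1)
qed

section \<open>Quantifier laws with named fresh variables\<close>

lemma entails_inst_Exi: "wf_fm S \<phi> \<Longrightarrow> wf_tm S t \<Longrightarrow> entails (inst t \<phi>) (Exi \<phi>)"
  unfolding entails_def by (intro ExiI Assm) (auto intro: wf_inst)

lemma entails_Uni_inst: "wf_fm S \<phi> \<Longrightarrow> wf_tm S t \<Longrightarrow> entails (Uni \<phi>) (inst t \<phi>)"
  unfolding entails_def by (intro UniE Assm) auto

text \<open>The substitution \<sigma> turns the named variable \<open>j\<close> into the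
  eigenvariable 0 and shifts all others. Without \<open>j\<close> this is just a shift; on an
  instance at a fresh \<open>j\<close> it undoes the instantiation.\<close>

lemma generalize_fresh:
  assumes "j \<notin> fv \<chi>" "Suc j \<notin> fv \<phi>"
  defines "\<sigma> \<equiv> \<lambda>i. Var (if i = j then 0 else Suc i)"
  shows "subst \<sigma> \<chi> = lift \<chi>" "subst \<sigma> (inst (Var j) \<phi>) = \<phi>"
proof -
  show "subst \<sigma> \<chi> = lift \<chi>"
    unfolding lift_def using assms by (intro subst_cong) auto
  show "subst \<sigma> (inst (Var j) \<phi>) = \<phi>"
    unfolding inst_def subst_comp using assms by (intro subst_ident) (auto split: nat.split)
qed

text \<open>Trades the shifted contexts of \<open>ExiE\<close> for a fresh named variable, which is
  an element of the model to be built; \<open>entails_UniI\<close> does the same for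
  \<open>UniI\<close>.\<close>

lemma entails_ExiI:
  assumes "wf_fm S \<phi>" "j \<notin> fv \<chi>" "Suc j \<notin> fv \<phi>" "entails (inst (Var j) \<phi>) \<chi>"
  shows "entails (Exi \<phi>) \<chi>"
proof -
  have "entails \<phi> (lift \<chi>)"
    using entails_subst[OF assms(4), of "\<lambda>i. Var (if i = j then 0 else Suc i)"]
    by (simp add: generalize_fresh[OF assms(2,3)])
  then have "deriv S (insert \<phi> (lift ` insert (Exi \<phi>) T)) (lift \<chi>)"
    unfolding entails_def by (rule deriv_mono) (auto simp: lift_theory)
  moreover have "deriv S (insert (Exi \<phi>) T) (Exi \<phi>)" using assms(1) by (intro Assm) auto
  ultimately show ?thesis unfolding entails_def by (rule ExiE[rotated])
qed

lemma entails_UniI: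
  assumes "j \<notin> fv \<chi>" "Suc j \<notin> fv \<phi>" "entails \<chi> (inst (Var j) \<phi>)"
  shows "entails \<chi> (Uni \<phi>)"
proof -
  have "entails (lift \<chi>) \<phi>"
    using entails_subst[OF assms(3), of "\<lambda>i. Var (if i = j then 0 else Suc i)"]
    by (simp add: generalize_fresh[OF assms(1,2)])
  then show ?thesis unfolding entails_def by (intro UniI) (simp add: lift_theory)
qed

section \<open>The quotient by interderivability over \<open>T\<close>\<close>

definition cls :: "('f, 'r) fm \<Rightarrow> ('f, 'r) fm set" where
  "cls \<phi> = {\<psi>. wf_fm S \<psi> \<and> entails \<phi> \<psi> \<and> entails \<psi> \<phi>}"

text \<open>The order asks for some pair of representatives; by transitivity every pair serves
  equally, which is \<open>le_cls\<close>.\<close>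

definition lindenbaum :: "('f, 'r) fm set gorder" where
  "lindenbaum = \<lparr>carrier = cls ` {\<phi>. wf_fm S \<phi>}, eq = (=),
     le = (\<lambda>A B. \<exists>\<phi>\<in>A. \<exists>\<psi>\<in>B. entails \<phi> \<psi>)\<rparr>"

lemma eq_lindenbaum [simp]: "eq lindenbaum = (=)"
  by (simp add: lindenbaum_def)

lemma cls_closed [simp]: "wf_fm S \<phi> \<Longrightarrow> cls \<phi> \<in> carrier lindenbaum"
  by (simp add: lindenbaum_def)

lemma carrierE:
  assumes "x \<in> carrier lindenbaum"
  obtains \<phi> where "wf_fm S \<phi>" "x = cls \<phi>"
  using assms by (auto simp: lindenbaum_def)

lemma cls_eq_iff:
  "wf_fm S \<phi> \<Longrightarrow> wf_fm S \<psi> \<Longrightarrow> cls \<phi> = cls \<psi> \<longleftrightarrow> entails \<phi> \<psi> \<and> entails \<psi> \<phi>"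
  unfolding cls_def by (blast intro: entails_trans entails_refl)

lemma le_cls [simp]:
  "wf_fm S \<phi> \<Longrightarrow> wf_fm S \<psi> \<Longrightarrow> cls \<phi> \<sqsubseteq>\<^bsub>lindenbaum\<^esub> cls \<psi> \<longleftrightarrow> entails \<phi> \<psi>"
  unfolding lindenbaum_def cls_def by simp (blast intro: entails_trans entails_refl)

lemma partial_order_lindenbaum: "partial_order lindenbaum"
  by (unfold_locales; (elim carrierE)?; clarsimp)
    (simp_all add: cls_eq_iff entails_refl, (blast intro: entails_trans)?)

interpretation partial_order lindenbaum
  by (rule partial_order_lindenbaum)

text \<open>Suprema are given by a choice operator, so antisymmetry is what pins down their
  value.\<close>

lemma sup_eqI: "is_lub lindenbaum x A \<Longrightarrow> \<Squnion>\<^bsub>lindenbaum\<^esub> A = x"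
  unfolding sup_def by (meson least_unique someI)

lemma inf_eqI: "is_glb lindenbaum x A \<Longrightarrow> \<Sqinter>\<^bsub>lindenbaum\<^esub> A = x"
  unfolding inf_def by (meson greatest_unique someI)

text \<open>Reduces an infimum to entailments between representatives. The set \<Phi> may be
  infinite: this covers both conjunctions and the instances of a universal formula.\<close>

lemma is_glb_clsI:
  assumes "wf_fm S \<alpha>" "\<And>\<phi>. \<phi> \<in> \<Phi> \<Longrightarrow> wf_fm S \<phi>" "\<And>\<phi>. \<phi> \<in> \<Phi> \<Longrightarrow> entails \<alpha> \<phi>"
    and "\<And>\<chi>. wf_fm S \<chi> \<Longrightarrow> (\<And>\<phi>. \<phi> \<in> \<Phi> \<Longrightarrow> entails \<chi> \<phi>) \<Longrightarrow> entails \<chi> \<alpha>"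
  shows "is_glb lindenbaum (cls \<alpha>) (cls ` \<Phi>)"
  unfolding greatest_def
proof (intro conjI ballI)
  show "Lower lindenbaum (cls ` \<Phi>) \<subseteq> carrier lindenbaum" by (auto simp: Lower_def)
  show "cls \<alpha> \<in> Lower lindenbaum (cls ` \<Phi>)" using assms(1-3) by (auto simp: Lower_def)
next
  fix x
  assume x: "x \<in> Lower lindenbaum (cls ` \<Phi>)"
  then obtain \<chi> where \<chi>: "wf_fm S \<chi>" "x = cls \<chi>" by (auto simp: Lower_def elim: carrierE)
  have "entails \<chi> \<phi>" if "\<phi> \<in> \<Phi>" for \<phi>
    using that x \<chi> assms(2) by (auto simp: Lower_def)
  then show "x \<sqsubseteq>\<^bsub>lindenbaum\<^esub> cls \<alpha>" using \<chi> assms(1,4) by simp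
qed

lemma is_lub_clsI:
  assumes "wf_fm S \<alpha>" "\<And>\<phi>. \<phi> \<in> \<Phi> \<Longrightarrow> wf_fm S \<phi>" "\<And>\<phi>. \<phi> \<in> \<Phi> \<Longrightarrow> entails \<phi> \<alpha>"
    and "\<And>\<chi>. wf_fm S \<chi> \<Longrightarrow> (\<And>\<phi>. \<phi> \<in> \<Phi> \<Longrightarrow> entails \<phi> \<chi>) \<Longrightarrow> entails \<alpha> \<chi>"
  shows "is_lub lindenbaum (cls \<alpha>) (cls ` \<Phi>)"
  unfolding least_def
proof (intro conjI ballI)
  show "Upper lindenbaum (cls ` \<Phi>) \<subseteq> carrier lindenbaum" by (auto simp: Upper_def)
  show "cls \<alpha> \<in> Upper lindenbaum (cls ` \<Phi>)" using assms(1-3) by (auto simp: Upper_def)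
next
  fix x
  assume x: "x \<in> Upper lindenbaum (cls ` \<Phi>)"
  then obtain \<chi> where \<chi>: "wf_fm S \<chi>" "x = cls \<chi>" by (auto simp: Upper_def elim: carrierE)
  have "entails \<phi> \<chi>" if "\<phi> \<in> \<Phi>" for \<phi>
    using that x \<chi> assms(2) by (auto simp: Upper_def)
  then show "cls \<alpha> \<sqsubseteq>\<^bsub>lindenbaum\<^esub> x" using \<chi> assms(1,4) by simp
qed

lemma is_glb_Con:
  "wf_fm S \<phi> \<Longrightarrow> wf_fm S \<psi> \<Longrightarrow> is_glb lindenbaum (cls (Con \<phi> \<psi>)) {cls \<phi>, cls \<psi>}"
  using is_glb_clsI[where \<alpha>="Con \<phi> \<psi>" and \<Phi>="{\<phi>, \<psi>}"]
  by (force simp: entails_Con1 entails_Con2 entails_Con_iff)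

lemma is_lub_Dis:
  "wf_fm S \<phi> \<Longrightarrow> wf_fm S \<psi> \<Longrightarrow> is_lub lindenbaum (cls (Dis \<phi> \<psi>)) {cls \<phi>, cls \<psi>}"
  using is_lub_clsI[where \<alpha>="Dis \<phi> \<psi>" and \<Phi>="{\<phi>, \<psi>}"]
  by (force simp: entails_Dis1 entails_Dis2 entails_Dis_iff)

lemma meet_cls [simp]:
  "wf_fm S \<phi> \<Longrightarrow> wf_fm S \<psi> \<Longrightarrow> cls \<phi> \<sqinter>\<^bsub>lindenbaum\<^esub> cls \<psi> = cls (Con \<phi> \<psi>)"
  unfolding meet_def by (intro inf_eqI is_glb_Con)

lemma join_cls [simp]:
  "wf_fm S \<phi> \<Longrightarrow> wf_fm S \<psi> \<Longrightarrow> cls \<phi> \<squnion>\<^bsub>lindenbaum\<^esub> cls \<psi> = cls (Dis \<phi> \<psi>)"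
  unfolding join_def by (intro sup_eqI is_lub_Dis)

lemma greatest_true: "greatest lindenbaum (cls (Neg Fls)) (carrier lindenbaum)"
  by (auto simp: greatest_def entails_true elim!: carrierE)

lemma least_Fls: "least lindenbaum (cls Fls) (carrier lindenbaum)"
  by (auto simp: least_def entails_Fls elim!: carrierE)

lemma top_lindenbaum: "\<top>\<^bsub>lindenbaum\<^esub> = cls (Neg Fls)"
  unfolding top_def using greatest_true by (meson greatest_unique someI)

lemma bottom_lindenbaum: "\<bottom>\<^bsub>lindenbaum\<^esub> = cls Fls"
  unfolding bottom_def using least_Fls by (meson least_unique someI)

text \<open>The source of both the model property and conservativity.\<close>

lemma cls_eq_top_iff: "wf_fm S \<phi> \<Longrightarrow> cls \<phi> = \<top>\<^bsub>lindenbaum\<^esub> \<longleftrightarrow> deriv S T \<phi>"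
  by (auto simp: top_lindenbaum cls_eq_iff entails_true intro: entails_Neg_Fls deriv_entails)

lemma Con_Neg_bottom: "wf_fm S \<phi> \<Longrightarrow> cls (Con \<phi> (Neg \<phi>)) = \<bottom>\<^bsub>lindenbaum\<^esub>"
  and Dis_Neg_top: "wf_fm S \<phi> \<Longrightarrow> cls (Dis \<phi> (Neg \<phi>)) = \<top>\<^bsub>lindenbaum\<^esub>"
  by (simp_all add: bottom_lindenbaum top_lindenbaum cls_eq_iff entails_Con_Neg entails_Fls
      entails_true entails_excluded_middle)

lemma compl_cls [simp]:
  assumes "wf_fm S \<phi>"
  shows "compl lindenbaum (cls \<phi>) = cls (Neg \<phi>)"
  unfolding compl_def
proof (rule the_equality)
  show "cls (Neg \<phi>) \<in> carrier lindenbaum \<and> cls \<phi> \<sqinter>\<^bsub>lindenbaum\<^esub> cls (Neg \<phi>) = \<bottom>\<^bsub>lindenbaum\<^esub>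
    \<and> cls \<phi> \<squnion>\<^bsub>lindenbaum\<^esub> cls (Neg \<phi>) = \<top>\<^bsub>lindenbaum\<^esub>"
    using assms by (simp add: Con_Neg_bottom Dis_Neg_top)
next
  fix y
  assume y: "y \<in> carrier lindenbaum \<and> cls \<phi> \<sqinter>\<^bsub>lindenbaum\<^esub> y = \<bottom>\<^bsub>lindenbaum\<^esub>
    \<and> cls \<phi> \<squnion>\<^bsub>lindenbaum\<^esub> y = \<top>\<^bsub>lindenbaum\<^esub>"
  then obtain \<psi> where \<psi>: "wf_fm S \<psi>" "y = cls \<psi>" by (blast elim: carrierE)
  then have "entails (Con \<phi> \<psi>) Fls" "entails (Neg Fls) (Dis \<phi> \<psi>)"
    using y assms by (simp_all add: bottom_lindenbaum top_lindenbaum cls_eq_iff)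
  then show "y = cls (Neg \<phi>)"
    using assms \<psi> entails_Neg_unique by (simp add: cls_eq_iff)
qed

lemma boolean_algebra_lindenbaum: "boolean_algebra_on lindenbaum"
proof
  fix x y
  assume "x \<in> carrier lindenbaum" "y \<in> carrier lindenbaum"
  then obtain \<phi> \<psi> where "wf_fm S \<phi>" "x = cls \<phi>" "wf_fm S \<psi>" "y = cls \<psi>"
    by (blast elim: carrierE)
  then show "\<exists>s. is_lub lindenbaum s {x, y}" "\<exists>s. is_glb lindenbaum s {x, y}"
    using is_lub_Dis is_glb_Con by blast+
next
  show "\<exists>x. least lindenbaum x (carrier lindenbaum)" using least_Fls by blast
  show "\<exists>x. greatest lindenbaum x (carrier lindenbaum)" using greatest_true by blast
next
  fix x y z
  assume "x \<in> carrier lindenbaum" "y \<in> carrier lindenbaum" "z \<in> carrier lindenbaum"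
  then obtain \<phi> \<psi> \<chi> where wf: "wf_fm S \<phi>" "wf_fm S \<psi>" "wf_fm S \<chi>"
    and eq: "x = cls \<phi>" "y = cls \<psi>" "z = cls \<chi>"
    by (metis carrierE)
  have "entails (Con \<phi> (Dis \<psi> \<chi>)) (Dis (Con \<phi> \<psi>) (Con \<phi> \<chi>))"
    using wf by (simp add: entails_Con_Dis entails_Dis1 entails_Dis2)
  moreover have "entails (Dis (Con \<phi> \<psi>) (Con \<phi> \<chi>)) (Con \<phi> (Dis \<psi> \<chi>))"
    \<comment> \<open>Read from right to left, \<open>entails_Con_Dis\<close> merges the two
      conditions into an instance of reflexivity.\<close>
    using wf by (simp add: entails_Dis_iff flip: entails_Con_Dis) (simp add: entails_refl)
  ultimately show "x \<sqinter>\<^bsub>lindenbaum\<^esub> (y \<squnion>\<^bsub>lindenbaum\<^esub> z)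
      = (x \<sqinter>\<^bsub>lindenbaum\<^esub> y) \<squnion>\<^bsub>lindenbaum\<^esub> (x \<sqinter>\<^bsub>lindenbaum\<^esub> z)"
    using wf by (simp add: eq cls_eq_iff)
next
  fix x
  assume "x \<in> carrier lindenbaum"
  then obtain \<phi> where "wf_fm S \<phi>" "x = cls \<phi>" by (blast elim: carrierE)
  then show "\<exists>y\<in>carrier lindenbaum.
      x \<sqinter>\<^bsub>lindenbaum\<^esub> y = \<bottom>\<^bsub>lindenbaum\<^esub> \<and> x \<squnion>\<^bsub>lindenbaum\<^esub> y = \<top>\<^bsub>lindenbaum\<^esub>"
    by (intro bexI[of _ "cls (Neg \<phi>)"]) (simp_all add: Con_Neg_bottom Dis_Neg_top)
qed

end

section \<open>The model of variables\<close>

text \<open>Entries beyond the end of the tuple are junk; they are kept well-formed so that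
  \<open>entails_subst\<close> applies.\<close>

definition env :: "'f tm list \<Rightarrow> nat \<Rightarrow> 'f tm" where
  "env m i = (if i < length m then m ! i else Var 0)"

lemma env_Cons: "env (t # m) = case_nat t (env m)"
  by (auto simp: env_def split: nat.split)

text \<open>The bound on \<open>i\<close> matters, since \<open>f\<close> may move the default
  \<open>Var 0\<close>. Formulas evaluated at \<open>m\<close> have their free variables below
  \<open>length m\<close>.\<close>

lemma env_map:
  assumes "i < length m"
  shows "env (map f m) i = f (env m i)"
  using assms by (simp add: env_def)

lemma wf_env: "m \<in> tuples n (range Var) \<Longrightarrow> wf_tm S (env m i)"
  by (force simp: env_def tuples_def subset_iff dest: nth_mem)

context closed_theory
begin

definition term_model :: "('f, 'r, ('f, 'r) fm set, 'f tm) bv_structure" where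
  "term_model = \<lparr>alg = lindenbaum, univ = range Var, val = \<lambda>\<phi> m. cls (subst (env m) \<phi>)\<rparr>"

lemma term_model_simps [simp]:
  "alg term_model = lindenbaum" "univ term_model = range Var"
  "val term_model \<phi> m = cls (subst (env m) \<phi>)"
  by (simp_all add: term_model_def)

text \<open>An upper bound of all variable instances has a class representative \<chi> with finitely
  many free variables, so one instance uses a variable fresh for \<chi> and \<phi>;
  \<open>entails_ExiI\<close> applies to it. Thus these suprema exist although the algebra need not
  be complete.\<close>

lemma is_lub_Exi:
  assumes "wf_fm S \<phi>"
  shows "is_lub lindenbaum (cls (Exi \<phi>)) (cls ` {inst k \<phi> | k. k \<in> range Var})"
proof (rule is_lub_clsI)
  fix \<chi>
  assume \<chi>: "\<And>\<psi>. \<psi> \<in> {inst k \<phi> | k. k \<in> range Var} \<Longrightarrow> entails \<psi> \<chi>"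
  obtain a b where "fv \<phi> \<subseteq> {..<a}" "fv \<chi> \<subseteq> {..<b}" using fv_bound by metis
  \<comment> \<open>The successor appears because free variables of the body are counted from 1,
    below the binder.\<close>
  then have "max a b \<notin> fv \<chi>" "Suc (max a b) \<notin> fv \<phi>" by auto
  then show "entails (Exi \<phi>) \<chi>" using assms \<chi> by (blast intro: entails_ExiI)
qed (use assms in \<open>auto intro: wf_inst entails_inst_Exi\<close>)

lemma is_glb_Uni:
  assumes "wf_fm S \<phi>"
  shows "is_glb lindenbaum (cls (Uni \<phi>)) (cls ` {inst k \<phi> | k. k \<in> range Var})"
proof (rule is_glb_clsI)
  fix \<chi>
  assume \<chi>: "\<And>\<psi>. \<psi> \<in> {inst k \<phi> | k. k \<in> range Var} \<Longrightarrow> entails \<chi> \<psi>"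
  obtain a b where "fv \<phi> \<subseteq> {..<a}" "fv \<chi> \<subseteq> {..<b}" using fv_bound by metis
  then have "max a b \<notin> fv \<chi>" "Suc (max a b) \<notin> fv \<phi>" by auto
  then show "entails \<chi> (Uni \<phi>)" using \<chi> by (blast intro: entails_UniI)
qed (use assms in \<open>auto intro: wf_inst entails_Uni_inst\<close>)

lemma instances_eq:
  "{val term_model \<phi> (k # m) | k. k \<in> univ term_model}
    = cls ` {inst k (subst (up (env m)) \<phi>) | k. k \<in> range Var}"
  by (auto simp: env_Cons inst_subst_up)

lemma wf_val: "m \<in> tuples n (range Var) \<Longrightarrow> fm_at S k \<phi> \<Longrightarrow> wf_fm S (subst (env m) \<phi>)"
  by (auto simp: fm_at_def intro!: wf_subst wf_env)

text \<open>Values are classes of substitution instances, and derivability from \<open>T\<close> is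
  closed under substitution.\<close>

lemma val_top_if_deriv:
  assumes "deriv S T \<phi>" "m \<in> tuples n (range Var)"
  shows "val term_model \<phi> m = \<top>\<^bsub>lindenbaum\<^esub>"
proof -
  have "deriv S T (subst (env m) \<phi>)"
    using deriv_subst[OF assms(1) wf_env[OF assms(2)]] by (simp add: subst_theory)
  then show ?thesis using deriv_wf[of S T "subst (env m) \<phi>"] by (simp add: cls_eq_top_iff)
qed

lemma bv_interpretation_term_model: "bv_interpretation S term_model"
proof (rule bv_interpretation.intro)
  fix m k n and \<phi> :: "('f, 'r) fm" and \<rho> :: "nat \<Rightarrow> nat"
  assume *: "m \<in> tuples k (univ term_model)" "fm_at S n \<phi>" "\<forall>i<n. \<rho> i < k"
  have "subst (env m) (subst (\<lambda>i. Var (\<rho> i)) \<phi>) = subst (env (map (\<lambda>i. m ! \<rho> i) [0..<n])) \<phi>"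
    unfolding subst_comp using * by (intro subst_cong) (auto simp: env_def fm_at_def tuples_def)
  then show "val term_model (subst (\<lambda>i. Var (\<rho> i)) \<phi>) m
      = val term_model \<phi> (map (\<lambda>i. m ! \<rho> i) [0..<n])" by simp
next
  fix m n and \<phi> :: "('f, 'r) fm"
  assume *: "m \<in> tuples n (univ term_model)" "fm_at S (Suc n) \<phi>"
  then have "wf_fm S (subst (up (env m)) \<phi>)"
    by (auto simp: fm_at_def intro!: wf_subst wf_up wf_env)
  then show
    "is_lub (alg term_model) (val term_model (Exi \<phi>) m)
      {val term_model \<phi> (k # m) | k. k \<in> univ term_model}"
    "is_glb (alg term_model) (val term_model (Uni \<phi>) m)
      {val term_model \<phi> (k # m) | k. k \<in> univ term_model}"
    unfolding instances_eq using is_lub_Exi is_glb_Uni by simp_all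
next
  fix m n and \<phi> :: "('f, 'r) fm"
  assume "m \<in> tuples n (univ term_model)" "deriv S {} \<phi>"
  then show "val term_model \<phi> m = \<top>\<^bsub>alg term_model\<^esub>"
    using val_top_if_deriv deriv_mono[of S "{}" \<phi> T] by simp
next
  fix m n and \<phi> \<psi> :: "('f, 'r) fm"
  assume "m \<in> tuples n (univ term_model)" "fm_at S n \<phi>" "fm_at S n \<psi>"
  then show "val term_model (Imp \<phi> \<psi>) m
      = compl (alg term_model) (val term_model \<phi> m) \<squnion>\<^bsub>alg term_model\<^esub> val term_model \<psi> m"
    using wf_val entails_Imp_Dis by (simp add: cls_eq_iff)
qed (use wf_val boolean_algebra_lindenbaum in \<open>simp_all add: bottom_lindenbaum\<close>)

lemma bv_model_term_model: "bv_model S T term_model"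
  using bv_interpretation_term_model val_top_if_deriv by (auto simp: bv_model_def bv_sat_def)

text \<open>At the empty tuple a sentence has its own class as value, and this is the top only for
  theorems of \<open>T\<close>.\<close>

lemma bv_conservative_term_model: "bv_conservative S T term_model"
  unfolding bv_conservative_def
proof (intro allI impI iffI)
  fix \<phi>
  assume \<phi>: "sentence S \<phi>" "bv_sat term_model \<phi>"
  then have "val term_model \<phi> [] = \<top>\<^bsub>lindenbaum\<^esub>"
    by (auto simp: bv_sat_def tuples_def sentence_def)
  moreover have "subst (env []) \<phi> = \<phi>" using \<phi> by (intro subst_ident) (simp add: sentence_def)
  ultimately show "deriv S T \<phi>" using \<phi> by (simp add: cls_eq_top_iff sentence_def)
qed (use bv_model_term_model in \<open>auto simp: bv_model_def\<close>)

section \<open>Automorphisms and definability\<close>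

definition rename :: "(nat \<Rightarrow> nat) \<Rightarrow> ('f, 'r) fm \<Rightarrow> ('f, 'r) fm" where
  "rename \<rho> = subst (\<lambda>i. Var (\<rho> i))"

lemma wf_rename [simp]: "wf_fm S \<phi> \<Longrightarrow> wf_fm S (rename \<rho> \<phi>)"
  by (simp add: rename_def wf_subst)

lemma entails_rename: "entails \<phi> \<psi> \<Longrightarrow> entails (rename \<rho> \<phi>) (rename \<rho> \<psi>)"
  by (simp add: rename_def entails_subst)

lemma rename_inverse: "(\<And>i. \<rho> (\<tau> i) = i) \<Longrightarrow> rename \<rho> (rename \<tau> \<phi>) = \<phi>"
  by (simp add: rename_def subst_comp subst_ident)

text \<open>Elements of the algebra are sets of formulas, so a permutation acts on them by direct
  image. Renaming by the inverse shows that the image is a full class.\<close>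

lemma rename_cls:
  assumes "bij \<rho>" "wf_fm S \<phi>"
  shows "rename \<rho> ` cls \<phi> = cls (rename \<rho> \<phi>)"
proof (intro equalityI subsetI)
  fix \<psi>
  assume "\<psi> \<in> rename \<rho> ` cls \<phi>"
  then show "\<psi> \<in> cls (rename \<rho> \<phi>)" by (auto simp: cls_def entails_rename)
next
  fix \<psi>
  assume \<psi>: "\<psi> \<in> cls (rename \<rho> \<phi>)"
  have inv: "rename (inv \<rho>) (rename \<rho> \<phi>) = \<phi>" "rename \<rho> (rename (inv \<rho>) \<psi>) = \<psi>"
    using assms(1) by (simp_all add: rename_inverse bij_is_inj bij_is_surj surj_f_inv_f)
  then have "rename (inv \<rho>) \<psi> \<in> cls \<phi>"
    using \<psi> entails_rename[of _ _ "inv \<rho>"]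
    by (metis (mono_tags, lifting) cls_def mem_Collect_eq wf_rename)
  then show "\<psi> \<in> rename \<rho> ` cls \<phi>" using inv(2) by (metis image_eqI)
qed

lemma bv_automorphism_rename:
  assumes "bij \<rho>"
  shows "bv_automorphism S term_model ((`) (rename \<rho>), subst_tm (\<lambda>i. Var (\<rho> i)))"
proof -
  let ?h = "(`) (rename \<rho>)"
  have cls: "?h (cls \<phi>) = cls (rename \<rho> \<phi>)" if "wf_fm S \<phi>" for \<phi>
    using assms that by (rule rename_cls)
  have inv: "rename \<rho> (rename (inv \<rho>) \<psi>) = \<psi>" for \<psi>
    using assms by (simp add: rename_inverse bij_is_surj surj_f_inv_f)
  have inj: "inj (rename \<rho>)"
    using assms by (intro inj_on_inverseI[of _ "rename (inv \<rho>)"]) (simp add: rename_inverse bij_is_inj)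
  have "bij_betw ?h (carrier lindenbaum) (carrier lindenbaum)"
  proof (rule bij_betw_imageI)
    show "inj_on ?h (carrier lindenbaum)"
      using inj by (meson inj_on_image_eq_iff inj_onI subset_UNIV)
    have "x \<in> ?h ` carrier lindenbaum" if x: "x \<in> carrier lindenbaum" for x
    proof -
      obtain \<phi> where "wf_fm S \<phi>" "x = cls \<phi>" using x by (rule carrierE)
      then have "x = ?h (cls (rename (inv \<rho>) \<phi>))" "wf_fm S (rename (inv \<rho>) \<phi>)"
        by (simp_all add: cls inv)
      then show ?thesis by (metis cls_closed image_eqI)
    qed
    moreover have "?h x \<in> carrier lindenbaum" if x: "x \<in> carrier lindenbaum" for x
      using x by (auto simp: cls elim!: carrierE)
    ultimately show "?h ` carrier lindenbaum = carrier lindenbaum" by blast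
  qed
  moreover have "?h (x \<sqinter>\<^bsub>lindenbaum\<^esub> y) = ?h x \<sqinter>\<^bsub>lindenbaum\<^esub> ?h y
      \<and> ?h (x \<squnion>\<^bsub>lindenbaum\<^esub> y) = ?h x \<squnion>\<^bsub>lindenbaum\<^esub> ?h y"
    if xy: "x \<in> carrier lindenbaum" "y \<in> carrier lindenbaum" for x y
  proof -
    obtain \<phi> \<psi> where "wf_fm S \<phi>" "x = cls \<phi>" "wf_fm S \<psi>" "y = cls \<psi>"
      using xy by (metis carrierE)
    then show ?thesis by (simp add: cls) (simp add: rename_def)
  qed
  moreover have "?h (compl lindenbaum x) = compl lindenbaum (?h x)"
    if x: "x \<in> carrier lindenbaum" for x
  proof -
    obtain \<phi> where "wf_fm S \<phi>" "x = cls \<phi>" using x by (rule carrierE)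
    then show ?thesis by (simp add: cls) (simp add: rename_def)
  qed
  moreover have "?h \<bottom>\<^bsub>lindenbaum\<^esub> = \<bottom>\<^bsub>lindenbaum\<^esub>" "?h \<top>\<^bsub>lindenbaum\<^esub> = \<top>\<^bsub>lindenbaum\<^esub>"
    by (simp_all add: bottom_lindenbaum top_lindenbaum cls) (simp_all add: rename_def)
  ultimately have "ba_automorphism lindenbaum ?h" by (simp add: ba_automorphism_def)
  moreover have "bij_betw (subst_tm (\<lambda>i. Var (\<rho> i))) (range Var) (range Var)"
  proof (rule bij_betw_imageI)
    show "inj_on (subst_tm (\<lambda>i. Var (\<rho> i))) (range Var)"
      using assms by (auto simp: inj_on_def dest: bij_is_inj[THEN injD])
    show "subst_tm (\<lambda>i. Var (\<rho> i)) ` range Var = range Var"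
      using assms by (auto simp: image_image) (metis bij_pointE rangeI)
  qed
  moreover have "?h (val term_model \<phi> m) = val term_model \<phi> (map (subst_tm (\<lambda>i. Var (\<rho> i))) m)"
    if \<phi>: "fm_at S n \<phi>" and m: "m \<in> tuples n (range Var)" for n \<phi> m
  proof -
    \<comment> \<open>Renaming a substituted formula amounts to renaming the tuple; only variables
      below \<open>n\<close> occur, so \<open>env_map\<close> applies.\<close>
    have "rename \<rho> (subst (env m) \<phi>) = subst (env (map (subst_tm (\<lambda>i. Var (\<rho> i))) m)) \<phi>"
      unfolding rename_def subst_comp using \<phi> m
      by (intro subst_cong) (auto simp: env_map fm_at_def tuples_def)
    then show ?thesis using cls wf_val[OF m \<phi>] by simp
  qed
  ultimately show ?thesis by (simp add: bv_automorphism_def)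
qed

text \<open>Invariance under the transposition of a variable \<open>y\<close> with a fresh one \<open>y'\<close> gives
  \<open>\<theta>(y) \<turnstile> \<theta>(y')\<close>, hence \<open>\<theta>\<close> is equivalent to \<open>\<forall>y. \<theta>(y)\<close>.\<close>

lemma eliminate_variables:
  assumes "wf_fm S \<theta>" "fv \<theta> \<subseteq> {..<n + k}"
    and "\<And>\<rho>. bij \<rho> \<Longrightarrow> (\<And>i. i < n \<Longrightarrow> \<rho> i = i) \<Longrightarrow> entails \<theta> (rename \<rho> \<theta>)"
  shows "\<exists>\<phi>. fm_at S n \<phi> \<and> entails \<phi> \<theta> \<and> entails \<theta> \<phi>"
  using assms
proof (induction k arbitrary: \<theta>)
  case 0
  then show ?case by (auto simp: fm_at_def intro: entails_refl)
next
  case (Suc k)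
  define N where "N = n + k"
  \<comment> \<open>The last variable \<open>N\<close> becomes the bound index 0, so
    \<open>Uni \<alpha>\<close> is \<theta> quantified over \<open>N\<close>.\<close>
  define \<alpha> where "\<alpha> = rename (\<lambda>i. if i = N then 0 else Suc i) \<theta>"
  have wf: "wf_fm S \<alpha>" using Suc.prems(1) by (simp add: \<alpha>_def)
  have fv_\<theta>: "fv \<theta> \<subseteq> {..N}" using Suc.prems(2) by (auto simp: N_def)
  have fv_\<alpha>: "fv \<alpha> \<subseteq> {..N}"
    unfolding \<alpha>_def rename_def using fv_\<theta> by (intro subset_trans[OF fv_rename]) auto
  have inst: "inst t \<alpha> = subst (\<lambda>i. if i = N then t else Var i) \<theta>" for t
    unfolding \<alpha>_def rename_def inst_def subst_comp by (rule subst_cong) auto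
  have "inst (Var N) \<alpha> = \<theta>" unfolding inst by (rule subst_ident) auto
  then have 1: "entails (Uni \<alpha>) \<theta>" using entails_Uni_inst[OF wf, of "Var N"] by simp
  \<comment> \<open>The transposition of \<open>N\<close> with \<open>Suc N\<close>, which is fresh
    for \<theta>. It fixes all indices below \<open>n\<close> because \<open>n\<close> is at most
    \<open>N\<close>.\<close>
  define \<tau> where "\<tau> i = (if i = N then Suc N else if i = Suc N then N else i)" for i
  have "bij \<tau>" by (rule o_bij[of \<tau>]) (auto simp: \<tau>_def)
  then have "entails \<theta> (rename \<tau> \<theta>)" by (rule Suc.prems(3)) (auto simp: \<tau>_def N_def)
  moreover have "inst (Var (Suc N)) \<alpha> = rename \<tau> \<theta>"
    unfolding inst rename_def using fv_\<theta> by (intro subst_cong) (auto simp: \<tau>_def)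
  ultimately have 2: "entails \<theta> (Uni \<alpha>)"
    using fv_\<theta> fv_\<alpha> by (intro entails_UniI[of "Suc N"]) auto
  have "\<exists>\<phi>. fm_at S n \<phi> \<and> entails \<phi> (Uni \<alpha>) \<and> entails (Uni \<alpha>) \<phi>"
  proof (rule Suc.IH)
    show "wf_fm S (Uni \<alpha>)" using wf by simp
    show "fv (Uni \<alpha>) \<subseteq> {..<n + k}" using fv_\<alpha> by (auto simp: N_def)
    \<comment> \<open>The invariance hypothesis passes to \<open>Uni \<alpha>\<close> because this
      formula is equivalent to \<theta>.\<close>
    show "entails (Uni \<alpha>) (rename \<rho> (Uni \<alpha>))" if "bij \<rho>" "\<And>i. i < n \<Longrightarrow> \<rho> i = i" for \<rho>
      using 1 2 Suc.prems(3)[OF that] by (meson entails_rename entails_trans)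
  qed
  then show ?case using 1 2 by (meson entails_trans)
qed

section \<open>Invariant predicates and equality of tuples\<close>

lemma entails_conj_iff: "entails \<chi> (foldr Con \<phi>s (Neg Fls)) \<longleftrightarrow> (\<forall>\<phi>\<in>set \<phi>s. entails \<chi> \<phi>)"
  by (induction \<phi>s) (auto simp: entails_Con_iff entails_true)

text \<open>The predicate condition says that \<phi> together with the equations between
  \<open>m\<close> and \<open>m'\<close> entails \<psi>. A substitution that identifies the two
  tuples makes the equations reflexive, so they drop out.\<close>

lemma bv_predicate_entails:
  assumes p: "bv_predicate term_model n p"
    and tuples: "m \<in> tuples n (range Var)" "m' \<in> tuples n (range Var)"
    and wf: "wf_fm S \<phi>" "wf_fm S \<psi>" and eq: "p m = cls \<phi>" "p m' = cls \<psi>"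
    and \<sigma>: "\<And>i. wf_tm S (\<sigma> i)" "\<And>i. i < n \<Longrightarrow> subst_tm \<sigma> (m ! i) = subst_tm \<sigma> (m' ! i)"
  shows "entails (subst \<sigma> \<phi>) (subst \<sigma> \<psi>)"
proof -
  let ?eqs = "map (\<lambda>i. Eqn (m ! i) (m' ! i)) [0..<n]"
  let ?E = "foldr Con ?eqs (Neg Fls)"
  have len: "length m = n" "length m' = n" using tuples by (auto simp: tuples_def)
  have wf_nth: "wf_tm S (m ! i)" "wf_tm S (m' ! i)" if "i < n" for i
    using that tuples wf_env[of m n S i] wf_env[of m' n S i] len by (auto simp: env_def)
  have wf_conj: "wf_fm S (foldr Con \<phi>s (Neg Fls)) \<longleftrightarrow> list_all (wf_fm S) \<phi>s"
    for \<phi>s :: "('f, 'r) fm list"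
    by (induction \<phi>s) auto
  have wf_E: "wf_fm S ?E" unfolding wf_conj using wf_nth by (auto simp: list_all_iff)
  \<comment> \<open>The infimum in \<open>eq_val\<close> is over finitely many equations, so it is
    the class of their conjunction. For \<open>n = 0\<close> this is truth.\<close>
  have "is_glb lindenbaum (cls ?E) (cls ` set ?eqs)"
  proof (rule is_glb_clsI[OF wf_E])
    show "wf_fm S \<xi>" if "\<xi> \<in> set ?eqs" for \<xi> using that wf_nth by auto
    show "entails ?E \<xi>" if "\<xi> \<in> set ?eqs" for \<xi>
      using that entails_refl[OF wf_E] entails_conj_iff by blast
    show "entails \<chi> ?E" if "\<And>\<xi>. \<xi> \<in> set ?eqs \<Longrightarrow> entails \<chi> \<xi>" for \<chi>
      using that entails_conj_iff by blast
  qed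
  moreover have "{val term_model (Eqn (Var 0) (Var 1)) [m ! i, m' ! i] | i. i < length m} = cls ` set ?eqs"
    by (auto simp: env_def len)
  ultimately have "eq_val term_model m m' = cls ?E"
    unfolding eq_val_def by (simp add: inf_eqI)
  then have "cls \<phi> \<sqinter>\<^bsub>lindenbaum\<^esub> cls ?E \<sqsubseteq>\<^bsub>lindenbaum\<^esub> cls \<psi>"
    using p tuples eq unfolding bv_predicate_def by (metis term_model_simps(1,2))
  then have "entails (Con \<phi> ?E) \<psi>" using wf wf_E by simp
  then have "entails (Con (subst \<sigma> \<phi>) (subst \<sigma> ?E)) (subst \<sigma> \<psi>)"
    using entails_subst[OF _ \<sigma>(1)] by fastforce
  moreover have "entails (subst \<sigma> \<phi>) (subst \<sigma> ?E)"
  proof -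
    have "subst \<sigma> (foldr Con \<phi>s (Neg Fls)) = foldr Con (map (subst \<sigma>) \<phi>s) (Neg Fls)"
      for \<phi>s :: "('f, 'r) fm list"
      by (induction \<phi>s) auto
    moreover have "entails (subst \<sigma> \<phi>) (Eqn t t)" if "wf_tm S t" for t
      unfolding entails_def using that by (rule EqnI)
    ultimately show ?thesis
      using \<sigma> wf_nth by (simp add: entails_conj_iff wf_subst_tm)
  qed
  ultimately show ?thesis
    using wf \<sigma>(1) by (meson entails_Con_iff entails_refl entails_trans wf_subst)
qed

lemma definable_if_invariant:
  assumes p: "bv_predicate term_model n p"
    and inv: "\<And>\<pi>. bv_automorphism S term_model \<pi> \<Longrightarrow> invariant_under term_model n p \<pi>"
  shows "definable S term_model n p"
proof -
  have p_closed: "p m \<in> carrier lindenbaum" if "m \<in> tuples n (range Var)" for m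
    using p that by (auto simp: bv_predicate_def)
  have p_rename: "rename \<rho> ` p (map Var xs) = p (map (\<lambda>i. Var (\<rho> i)) xs)"
    if "bij \<rho>" "length xs = n" for \<rho> xs
  proof -
    have "map Var xs \<in> tuples n (range Var)" using that(2) by (auto simp: tuples_def)
    moreover have "\<forall>m\<in>tuples n (range Var). rename \<rho> ` p m = p (map (subst_tm (\<lambda>i. Var (\<rho> i))) m)"
      using inv[OF bv_automorphism_rename[OF that(1)]] by (simp add: invariant_under_def)
    ultimately have "rename \<rho> ` p (map Var xs)
        = p (map (subst_tm (\<lambda>i. Var (\<rho> i))) (map Var xs))" by blast
    then show ?thesis by (simp add: comp_def)
  qed
  \<comment> \<open>The generic tuple: its entries are the variables that a defining formula of
    arity \<open>n\<close> may contain.\<close>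
  let ?x = "map Var [0..<n]"
  have "?x \<in> tuples n (range Var)" by (auto simp: tuples_def)
  then obtain \<theta> where \<theta>: "wf_fm S \<theta>" "p ?x = cls \<theta>" using p_closed carrierE by metis
  obtain k where k: "fv \<theta> \<subseteq> {..<k}" using fv_bound by blast
  have "\<exists>\<phi>. fm_at S n \<phi> \<and> entails \<phi> \<theta> \<and> entails \<theta> \<phi>"
  proof (rule eliminate_variables)
    show "wf_fm S \<theta>" by (fact \<theta>)
    show "fv \<theta> \<subseteq> {..<n + k}" using k by auto
    fix \<rho> :: "nat \<Rightarrow> nat"
    assume \<rho>: "bij \<rho>" "\<And>i. i < n \<Longrightarrow> \<rho> i = i"
    \<comment> \<open>Since \<rho> fixes the generic tuple, invariance makes the value of
      \<open>p\<close> there a fixed point of the renaming.\<close>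
    have "map (\<lambda>i. Var (\<rho> i)) [0..<n] = ?x" using \<rho>(2) by simp
    then have "rename \<rho> ` cls \<theta> = cls \<theta>"
      using p_rename[OF \<rho>(1), of "[0..<n]"] \<theta>(2) by (metis diff_zero length_upt)
    then have "cls (rename \<rho> \<theta>) = cls \<theta>" using \<theta>(1) \<rho>(1) by (simp add: rename_cls)
    then show "entails \<theta> (rename \<rho> \<theta>)" using \<theta> by (simp add: cls_eq_iff)
  qed
  then obtain \<phi> where \<phi>: "fm_at S n \<phi>" "entails \<phi> \<theta>" "entails \<theta> \<phi>" by blast
  then have wf: "wf_fm S \<phi>" and fv: "fv \<phi> \<subseteq> {..<n}" by (auto simp: fm_at_def)
  have p_x: "p ?x = cls \<phi>" using \<phi> wf \<theta> by (simp add: cls_eq_iff)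
  \<comment> \<open>Invariance carries the equation \<open>p_x\<close> from the generic tuple to a
    block of variables starting at any \<open>K\<close> from \<open>n\<close> on.\<close>
  have fresh: "p (map (\<lambda>i. Var (K + i)) [0..<n]) = cls (rename (\<lambda>i. K + i) \<phi>)" if "n \<le> K" for K
  proof -
    \<comment> \<open>The shift by \<open>K\<close> need not be a permutation, so \<rho> exchanges
      the two blocks instead. They are disjoint as \<open>n \<le> K\<close>, which makes \<rho> an
      involution.\<close>
    define \<rho> where "\<rho> i = (if i < n then K + i else if K \<le> i \<and> i < K + n then i - K else i)" for i
    have "\<rho> (\<rho> i) = i" for i using that by (auto simp: \<rho>_def)
    then have "bij \<rho>" by (intro o_bij[of \<rho>]) auto
    moreover have "rename \<rho> \<phi> = rename (\<lambda>i. K + i) \<phi>"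
      unfolding rename_def using fv by (intro subst_cong) (auto simp: \<rho>_def)
    moreover have "map (\<lambda>i. Var (\<rho> i)) [0..<n] = map (\<lambda>i. Var (K + i)) [0..<n]"
      by (simp add: \<rho>_def)
    ultimately show ?thesis
      using p_rename[of \<rho> "[0..<n]"] p_x rename_cls[OF _ wf] by (metis diff_zero length_upt)
  qed
  have "p m = val term_model \<phi> m" if m: "m \<in> tuples n (range Var)" for m
  proof -
    obtain \<chi> where \<chi>: "wf_fm S \<chi>" "p m = cls \<chi>" using p_closed[OF m] by (rule carrierE)
    have len: "length m = n" using m by (simp add: tuples_def)
    have "finite (fv \<chi> \<union> \<Union> (fv_tm ` set m) \<union> {..<n})" by (simp add: finite_fv finite_fv_tm)
    then obtain K where K: "fv \<chi> \<union> \<Union> (fv_tm ` set m) \<union> {..<n} \<subseteq> {..<K}"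
      unfolding finite_nat_set_iff_bounded by blast
    let ?y = "map (\<lambda>i. Var (K + i)) [0..<n]"
    \<comment> \<open>Puts the entries of \<open>m\<close> for the fresh block. Hence \<sigma>
      identifies \<open>m\<close> with \<open>?y\<close>, fixes \<chi>, and turns \<phi> at the
      block into \<phi> at \<open>m\<close>, even if \<open>m\<close> has repeated entries.\<close>
    define \<sigma> where "\<sigma> i = (if K \<le> i \<and> i < K + n then m ! (i - K) else Var i)" for i
    have wf_\<sigma>: "wf_tm S (\<sigma> i)" for i
      using wf_env[OF m, of S "i - K"] len by (auto simp: \<sigma>_def env_def split: if_splits)
    have n_K: "n \<le> K" using K by (auto simp: subset_iff not_le[symmetric])
    have y: "?y \<in> tuples n (range Var)" by (auto simp: tuples_def)
    have \<sigma>_eq: "subst_tm \<sigma> (m ! i) = subst_tm \<sigma> (?y ! i)" if "i < n" for i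
    proof -
      have "fv_tm (m ! i) \<subseteq> {..<K}" using K that len by (auto dest: nth_mem)
      then have "subst_tm \<sigma> (m ! i) = subst_tm Var (m ! i)"
        by (intro subst_tm_cong) (auto simp: \<sigma>_def)
      then show ?thesis using that by (simp add: \<sigma>_def)
    qed
    have \<sigma>_\<chi>: "subst \<sigma> \<chi> = \<chi>" using K by (intro subst_ident) (auto simp: \<sigma>_def)
    have \<sigma>_\<phi>: "subst \<sigma> (rename (\<lambda>i. K + i) \<phi>) = subst (env m) \<phi>"
      unfolding rename_def subst_comp using fv len by (intro subst_cong) (auto simp: \<sigma>_def env_def)
    note p_y = fresh[OF n_K]
    have "entails \<chi> (subst (env m) \<phi>)"
      using bv_predicate_entails[OF p m y \<chi>(1) wf_rename[OF wf] \<chi>(2) p_y, of \<sigma>] wf_\<sigma> \<sigma>_eq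
      by (simp only: \<sigma>_\<chi> \<sigma>_\<phi>)
    moreover have "entails (subst (env m) \<phi>) \<chi>"
      using bv_predicate_entails[OF p y m wf_rename[OF wf] \<chi>(1) p_y \<chi>(2), of \<sigma>] wf_\<sigma> \<sigma>_eq
      by (simp only: \<sigma>_\<chi> \<sigma>_\<phi>)
    ultimately show ?thesis using \<chi> wf_val[OF m \<phi>(1)] by (simp add: cls_eq_iff)
  qed
  then show ?thesis using \<phi>(1) by (auto simp: definable_def)
qed

end

theorem theorem2p1:
  fixes S :: "('f, 'r) signature" and T :: "('f, 'r) fm set"
  assumes "fo_theory S T"
  shows "\<exists>M :: ('f, 'r, ('f, 'r) fm set, 'f tm) bv_structure.
    bv_model S T M \<and>
    bv_conservative S T M \<and>
    (\<forall>n p. bv_predicate M n p \<and>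
       (\<forall>\<pi>. bv_automorphism S M \<pi> \<longrightarrow> invariant_under M n p \<pi>) \<longrightarrow> definable S M n p)"
proof -
  interpret closed_theory S T by unfold_locales (fact assms)
  show ?thesis
    using bv_model_term_model bv_conservative_term_model definable_if_invariant by blast
qed

end
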